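(* Let $\mathcal{H}$ be a complex Hilbert space and let $v_1,v_2\in\mathcal{H}$ be linearly independent with $\operatorname{Im}\langle v_1,v_2\rangle\neq0$. Let $T=l(v_1)+l(v_1)^*+i(r(v_2)+r(v_2)^* )$, acting on the reducing subspace $\overline{\operatorname{alg}(T,T^*,1)\Omega}$ of the full Fock space $\mathcal{F}(\mathcal{H})$. Then the essential spectrum $\sigma_e(T)$ of $T$ is the closed rectangle $$\{\gamma+i\delta\in\mathbb{C} : |\gamma|\le 2\|v_1\|\text{ and }|\delta|\le 2\|v_2\|\},$$ and this rectangle equals the spectrum $\sigma(T)$ of $T$.
   Context: Inner products are linear in the first variable. The full Fock space on $\mathcal{H}$ is $\mathcal{F}(\mathcal{H})=\mathbb{C}\Omega\oplus\bigoplus_{n\ge1}\mathcal{H}^{\otimes n}$, with $\Omega$ a unit vector (the vacuum vector). For $\xi\in\mathcal{H}$, the left creation operator $l(\xi)\in B(\mathcal{F}(\mathcal{H}))$ is given by $l(\xi)\Omega=\xi$, $l(\xi)(\xi_1\otimes\cdots\otimes\xi_n)=\xi\otimes\xi_1\otimes\cdots\otimes\xi_n$, and the right creation operator $r(\xi)$ by $r(\xi)\Omega=\xi$, $r(\xi)(\xi_1\otimes\cdots\otimes\xi_n)=\xi_1\otimes\cdots\otimes\xi_n\otimes\xi$. $\operatorname{alg}(T,T^*,1)$ is the unital algebra generated by $T$ and $T^*$. The essential spectrum is the spectrum of the image in the Calkin algebra. *)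

theory Defs
  imports "HOL-Analysis.Analysis" "HOL-Algebra.QuotRing"
begin

section \<open>Complex Hilbert spaces\<close>

text \<open>The norm, metric and topology are those of the underlying real normed space, tied to the
  inner product by \<open>cinner_norm\<close>. The inner product is linear in the first variable.\<close>

class complex_inner = real_normed_vector +
  fixes scaleC :: "complex \<Rightarrow> 'a \<Rightarrow> 'a" (infixr \<open>*\<^sub>C\<close> 75)
    and cinner :: "'a \<Rightarrow> 'a \<Rightarrow> complex"
  assumes scaleC_add_right: "a *\<^sub>C (x + y) = a *\<^sub>C x + a *\<^sub>C y"
    and scaleC_add_left: "(a + b) *\<^sub>C x = a *\<^sub>C x + b *\<^sub>C x"
    and scaleC_scaleC: "a *\<^sub>C b *\<^sub>C x = (a * b) *\<^sub>C x"
    and scaleC_of_real: "of_real r *\<^sub>C x = r *\<^sub>R x"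
    and cinner_add_left: "cinner (x + y) z = cinner x z + cinner y z"
    and cinner_scaleC_left: "cinner (a *\<^sub>C x) y = a * cinner x y"
    and cinner_commute: "cinner x y = cnj (cinner y x)"
    and cinner_norm: "cinner x x = of_real ((norm x)\<^sup>2)"

class chilbert_space = complex_inner + complete_space

instance chilbert_space \<subseteq> banach ..

global_interpretation complex_vector: vector_space "scaleC :: complex \<Rightarrow> 'a::complex_inner \<Rightarrow> 'a"
  defines cindependent = complex_vector.independent
    and cspan = complex_vector.span
    and csubspace = complex_vector.subspace
proof
  fix x :: 'a
  show "1 *\<^sub>C x = x"
    using scaleC_of_real[of 1 x] by simp
qed (rule scaleC_add_right scaleC_add_left scaleC_scaleC)+


definition bounded_clinear :: "('a::complex_inner \<Rightarrow> 'b::complex_inner) \<Rightarrow> bool" where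
  "bounded_clinear A \<longleftrightarrow> bounded_linear A \<and> (\<forall>c x. A (c *\<^sub>C x) = c *\<^sub>C A x)"

definition cadjoint :: "('a::complex_inner \<Rightarrow> 'b::complex_inner) \<Rightarrow> 'b \<Rightarrow> 'a" where
  "cadjoint A = (THE B. bounded_clinear B \<and> (\<forall>x y. cinner (A x) y = cinner x (B y)))"

text \<open>The unital algebra generated by a set of operators.\<close>

inductive_set op_alg :: "('a::complex_inner \<Rightarrow> 'a) set \<Rightarrow> ('a \<Rightarrow> 'a) set"
  for S :: "('a \<Rightarrow> 'a) set" where
  one: "id \<in> op_alg S"
| gen: "A \<in> S \<Longrightarrow> A \<in> op_alg S"
| add: "A \<in> op_alg S \<Longrightarrow> B \<in> op_alg S \<Longrightarrow> (\<lambda>x. A x + B x) \<in> op_alg S"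
| scale: "A \<in> op_alg S \<Longrightarrow> (\<lambda>x. c *\<^sub>C A x) \<in> op_alg S"
| mult: "A \<in> op_alg S \<Longrightarrow> B \<in> op_alg S \<Longrightarrow> A \<circ> B \<in> op_alg S"


section \<open>Spectrum and essential spectrum of an operator on a closed subspace\<close>

text \<open>\<open>bounded_ops K\<close> is the algebra of bounded operators on a closed subspace \<open>K\<close>. To make an
  operator determined by its values on \<open>K\<close>, it is required to be \<open>undefined\<close> outside \<open>K\<close>.\<close>

definition bounded_ops :: "'a::complex_inner set \<Rightarrow> ('a \<Rightarrow> 'a) ring" where
  "bounded_ops K =
    \<lparr> carrier = {A \<in> K \<rightarrow>\<^sub>E K.
        (\<forall>x\<in>K. \<forall>y\<in>K. A (x + y) = A x + A y) \<and> (\<forall>c. \<forall>x\<in>K. A (c *\<^sub>C x) = c *\<^sub>C A x) \<and>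
        (\<exists>M. \<forall>x\<in>K. norm (A x) \<le> M * norm x)},
      mult = (\<lambda>A B. \<lambda>x\<in>K. A (B x)),
      one = (\<lambda>x\<in>K. x),
      zero = (\<lambda>x\<in>K. 0),
      add = (\<lambda>A B. \<lambda>x\<in>K. A x + B x) \<rparr>"

definition compact_ops :: "'a::complex_inner set \<Rightarrow> ('a \<Rightarrow> 'a) set" where
  "compact_ops K = {A \<in> carrier (bounded_ops K). compact (closure (A ` (K \<inter> cball 0 1)))}"

definition calkin_algebra :: "'a::complex_inner set \<Rightarrow> ('a \<Rightarrow> 'a) set ring" where
  "calkin_algebra K = bounded_ops K Quot compact_ops K"

definition calkin_map :: "'a::complex_inner set \<Rightarrow> ('a \<Rightarrow> 'a) \<Rightarrow> ('a \<Rightarrow> 'a) set" where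
  "calkin_map K A = compact_ops K +>\<^bsub>bounded_ops K\<^esub> A"

text \<open>In the following two definitions \<open>T\<close> may be an operator on a larger space leaving \<open>K\<close>
  invariant; only its restriction to \<open>K\<close> matters.\<close>

definition op_spectrum :: "'a::complex_inner set \<Rightarrow> ('a \<Rightarrow> 'a) \<Rightarrow> complex set" where
  "op_spectrum K T = {z. (\<lambda>x\<in>K. T x - z *\<^sub>C x) \<notin> Units (bounded_ops K)}"

definition essential_spectrum :: "'a::complex_inner set \<Rightarrow> ('a \<Rightarrow> 'a) \<Rightarrow> complex set" where
  "essential_spectrum K T =
    {z. calkin_map K (\<lambda>x\<in>K. T x - z *\<^sub>C x) \<notin> Units (calkin_algebra K)}"


section \<open>The full Fock space\<close>

text \<open>A Hilbert space \<open>'f\<close> is a full Fock space over \<open>'h\<close> by means of the map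
  \<open>tens [x\<^sub>1, \<dots>, x\<^sub>n] = x\<^sub>1 \<otimes> \<dots> \<otimes> x\<^sub>n\<close>: on lists of length \<open>n\<close> this map is the canonical
  multilinear map onto the elementary tensors of the \<open>n\<close>-th tensor power, different tensor powers
  are mutually orthogonal, and \<open>'f\<close> is the closed linear span of all of them. The
  empty tensor \<open>tens []\<close> is the vacuum vector (its norm is 1 by the inner product formula, the empty
  product being 1). Such a space is unique up to a unitary respecting the elementary
  tensors; existence is \<open>full_fock_space_exists\<close> below.\<close>

definition full_fock_space :: "('h::chilbert_space list \<Rightarrow> 'f::chilbert_space) \<Rightarrow> bool" where
  "full_fock_space tens \<longleftrightarrow>
    (\<forall>xs x y ys. tens (xs @ (x + y) # ys) = tens (xs @ x # ys) + tens (xs @ y # ys)) \<and>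
    (\<forall>xs c x ys. tens (xs @ (c *\<^sub>C x) # ys) = c *\<^sub>C tens (xs @ x # ys)) \<and>
    (\<forall>xs ys. length xs = length ys \<longrightarrow>
      cinner (tens xs) (tens ys) = (\<Prod>i<length xs. cinner (xs ! i) (ys ! i))) \<and>
    (\<forall>xs ys. length xs \<noteq> length ys \<longrightarrow> cinner (tens xs) (tens ys) = 0) \<and>
    closure (cspan (range tens)) = UNIV"

definition vacuum :: "('h::chilbert_space list \<Rightarrow> 'f::chilbert_space) \<Rightarrow> 'f" where
  "vacuum tens = tens []"

definition left_creation ::
    "('h::chilbert_space list \<Rightarrow> 'f::chilbert_space) \<Rightarrow> 'h \<Rightarrow> 'f \<Rightarrow> 'f" where
  "left_creation tens \<xi> = (THE A. bounded_clinear A \<and> (\<forall>xs. A (tens xs) = tens (\<xi> # xs)))"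

definition right_creation ::
    "('h::chilbert_space list \<Rightarrow> 'f::chilbert_space) \<Rightarrow> 'h \<Rightarrow> 'f \<Rightarrow> 'f" where
  "right_creation tens \<xi> = (THE A. bounded_clinear A \<and> (\<forall>xs. A (tens xs) = tens (xs @ [\<xi>])))"


section \<open>Basic facts about the inner product\<close>

lemma cinner_add_right: "cinner x (y + z) = cinner x y + cinner x z"
  for x :: "'a::complex_inner"
  by (metis cinner_add_left cinner_commute complex_cnj_add)

lemma cinner_scaleC_right: "cinner x (c *\<^sub>C y) = cnj c * cinner x y"
  for x :: "'a::complex_inner"
  by (metis cinner_scaleC_left cinner_commute complex_cnj_mult)

lemma cinner_zero_left [simp]: "cinner 0 x = 0" for x :: "'a::complex_inner"
  using cinner_add_left[of 0 0 x] by simp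

lemma cinner_zero_right [simp]: "cinner x 0 = 0" for x :: "'a::complex_inner"
  using cinner_add_right[of x 0 0] by simp

lemma cinner_minus_left: "cinner (- x) y = - cinner x y" for x :: "'a::complex_inner"
  using cinner_add_left[of "- x" x y] by (simp add: eq_neg_iff_add_eq_0)

lemma cinner_diff_left: "cinner (x - y) z = cinner x z - cinner y z" for x :: "'a::complex_inner"
  using cinner_add_left[of x "- y" z] by (simp add: cinner_minus_left)

lemma cinner_sum_left: "cinner (sum f S) y = (\<Sum>i\<in>S. cinner (f i) y)"
  for f :: "_ \<Rightarrow> 'a::complex_inner"
  by (induction S rule: infinite_finite_induct) (auto simp: cinner_add_left)

lemma cinner_sum_right: "cinner y (sum f S) = (\<Sum>i\<in>S. cinner y (f i))"
  for f :: "_ \<Rightarrow> 'a::complex_inner"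
  by (induction S rule: infinite_finite_induct) (auto simp: cinner_add_right)

lemma norm_scaleC: "norm (c *\<^sub>C x) = cmod c * norm x" for x :: "'a::complex_inner"
proof -
  have "of_real ((norm (c *\<^sub>C x))\<^sup>2) = (of_real ((cmod c * norm x)\<^sup>2) :: complex)"
    unfolding cinner_norm[symmetric] power_mult_distrib of_real_mult
    using complex_norm_square[of c]
    by (simp add: cinner_scaleC_left cinner_scaleC_right mult.commute)
  then show ?thesis
    by (metis norm_ge_zero mult_nonneg_nonneg of_real_eq_iff power2_eq_imp_eq)
qed

lemma norm_add_square: "(norm (x + y))\<^sup>2 = (norm x)\<^sup>2 + (norm y)\<^sup>2 + 2 * Re (cinner x y)"
  for x :: "'a::complex_inner"
proof -
  have sq: "(norm z)\<^sup>2 = Re (cinner z z)" for z :: 'a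
    by (simp add: cinner_norm)
  have "Re (cinner y x) = Re (cinner x y)"
    by (subst cinner_commute) simp
  then show ?thesis
    by (simp add: sq cinner_add_left cinner_add_right)
qed

lemma cinner_Cauchy_Schwarz: "cmod (cinner x y) \<le> norm x * norm y"
  for x :: "'a::complex_inner"
proof -
  have *: "Re (cinner u y) \<le> norm u * norm y" for u
  proof -
    have "(norm (u + y))\<^sup>2 \<le> (norm u + norm y)\<^sup>2"
      by (intro power_mono norm_triangle_ineq) simp
    then show ?thesis
      by (simp add: norm_add_square power2_sum)
  qed
  define c where "c = cnj (sgn (cinner x y))"
  have "Re (cinner (c *\<^sub>C x) y) = cmod (cinner x y)"
    by (simp add: c_def cinner_scaleC_left sgn_eq complex_norm_square[symmetric]
        power2_eq_square mult.commute flip: of_real_mult)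
  moreover have "norm (c *\<^sub>C x) \<le> norm x"
    by (simp add: c_def norm_scaleC norm_sgn)
  ultimately show ?thesis
    using *[of "c *\<^sub>C x"] mult_right_mono[of "norm (c *\<^sub>C x)" "norm x" "norm y"] by simp
qed

lemma bounded_linear_cinner_left: "bounded_linear (\<lambda>x. cinner x y)"
  for y :: "'a::complex_inner"
  by (rule bounded_linear_intro[where K = "norm y"])
    (simp_all add: cinner_add_left cinner_scaleC_left cinner_Cauchy_Schwarz
      scaleC_of_real[symmetric] scaleR_conv_of_real)

section \<open>The algebra of bounded operators and the ideal of compact operators\<close>

lemma ring_bounded_ops:
  fixes K :: "'a::complex_inner set"
  assumes K: "csubspace K"
  shows "ring (bounded_ops K)"
proof -
  have K0: "0 \<in> K" and Kadd: "\<And>x y. x \<in> K \<Longrightarrow> y \<in> K \<Longrightarrow> x + y \<in> K"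
    and Ksc: "\<And>c x. x \<in> K \<Longrightarrow> c *\<^sub>C x \<in> K"
    using K by (auto simp: complex_vector.subspace_def)
  have Kneg: "- x \<in> K" if "x \<in> K" for x
    using Ksc[OF that, of "-1"] by simp
  have scneg: "c *\<^sub>C (- x) = - (c *\<^sub>C x)" for c and x :: 'a
    by simp
  show ?thesis
  proof (intro ringI abelian_groupI monoidI)
    fix A B assume "A \<in> carrier (bounded_ops K)" "B \<in> carrier (bounded_ops K)"
    then have A: "\<And>x. x \<in> K \<Longrightarrow> A x \<in> K" "\<And>x y. x \<in> K \<Longrightarrow> y \<in> K \<Longrightarrow> A (x + y) = A x + A y"
        "\<And>c x. x \<in> K \<Longrightarrow> A (c *\<^sub>C x) = c *\<^sub>C A x"
      and B: "\<And>x. x \<in> K \<Longrightarrow> B x \<in> K" "\<And>x y. x \<in> K \<Longrightarrow> y \<in> K \<Longrightarrow> B (x + y) = B x + B y"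
        "\<And>c x. x \<in> K \<Longrightarrow> B (c *\<^sub>C x) = c *\<^sub>C B x"
      and bd: "\<exists>M. \<forall>x\<in>K. norm (A x) \<le> M * norm x" "\<exists>M. \<forall>x\<in>K. norm (B x) \<le> M * norm x"
      by (auto simp: bounded_ops_def)
    from bd obtain M N where M: "\<And>x. x \<in> K \<Longrightarrow> norm (A x) \<le> M * norm x"
      and N: "\<And>x. x \<in> K \<Longrightarrow> norm (B x) \<le> N * norm x"
      by blast
    have "norm (A x + B x) \<le> (M + N) * norm x" if "x \<in> K" for x
      using M[OF that] N[OF that] norm_triangle_ineq[of "A x" "B x"] by (simp add: algebra_simps)
    then show "A \<oplus>\<^bsub>bounded_ops K\<^esub> B \<in> carrier (bounded_ops K)"
      by (auto simp: bounded_ops_def A B Kadd Ksc complex_vector.scale_right_distrib intro!: exI[of _ "M + N"])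
    have "norm (A (B x)) \<le> (\<bar>M\<bar> * \<bar>N\<bar>) * norm x" if "x \<in> K" for x
    proof -
      have "norm (A (B x)) \<le> M * norm (B x)" by (rule M[OF B(1)[OF that]])
      also have "\<dots> \<le> \<bar>M\<bar> * (\<bar>N\<bar> * norm x)"
        by (intro mult_mono order_trans[OF N[OF that] mult_right_mono]) auto
      finally show ?thesis by simp
    qed
    then show "A \<otimes>\<^bsub>bounded_ops K\<^esub> B \<in> carrier (bounded_ops K)"
      by (auto simp: bounded_ops_def A B Kadd Ksc intro!: exI[of _ "\<bar>M\<bar> * \<bar>N\<bar>"])
    show "\<exists>C\<in>carrier (bounded_ops K). C \<oplus>\<^bsub>bounded_ops K\<^esub> A = \<zero>\<^bsub>bounded_ops K\<^esub>"
      by (rule bexI[of _ "\<lambda>x\<in>K. - A x"])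
        (auto simp: bounded_ops_def A Kadd Ksc Kneg scneg M intro!: exI[of _ M])
  next
    fix A assume "A \<in> carrier (bounded_ops K)"
    then show "\<zero>\<^bsub>bounded_ops K\<^esub> \<oplus>\<^bsub>bounded_ops K\<^esub> A = A" "\<one>\<^bsub>bounded_ops K\<^esub> \<otimes>\<^bsub>bounded_ops K\<^esub> A = A"
      "A \<otimes>\<^bsub>bounded_ops K\<^esub> \<one>\<^bsub>bounded_ops K\<^esub> = A"
      by (auto simp: bounded_ops_def fun_eq_iff PiE_def extensional_def Pi_def restrict_def)
  next
    show "\<one>\<^bsub>bounded_ops K\<^esub> \<in> carrier (bounded_ops K)"
      by (auto simp: bounded_ops_def Kadd Ksc intro!: exI[of _ 1])
    show "\<zero>\<^bsub>bounded_ops K\<^esub> \<in> carrier (bounded_ops K)"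
      by (auto simp: bounded_ops_def Kadd Ksc K0 intro!: exI[of _ 0])
  qed (auto simp: bounded_ops_def fun_eq_iff restrict_def add_ac PiE_iff)
qed

lemma compact_closure_subset:
  fixes S C :: "'a::t2_space set"
  assumes "compact C" "S \<subseteq> C"
  shows "compact (closure S)"
proof -
  have "closure S \<subseteq> C"
    using assms by (simp add: closure_minimal compact_imp_closed)
  then show ?thesis
    using compact_Int_closed[OF assms(1) closed_closure[of S]] by (simp add: Int_absorb1)
qed

lemma ideal_compact_ops:
  fixes K :: "'a::complex_inner set"
  assumes K: "csubspace K" and cl: "closed K"
  shows "ideal (compact_ops K) (bounded_ops K)"
proof -
  interpret R: ring "bounded_ops K" by (rule ring_bounded_ops[OF K])
  define S where "S = K \<inter> cball 0 1"
  have S: "S \<subseteq> K" by (auto simp: S_def)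
  have K0: "0 \<in> K" and Kadd: "\<And>x y. x \<in> K \<Longrightarrow> y \<in> K \<Longrightarrow> x + y \<in> K"
    and Ksc: "\<And>c x. x \<in> K \<Longrightarrow> c *\<^sub>C x \<in> K"
    using K by (auto simp: complex_vector.subspace_def)
  have Ksc': "r *\<^sub>R x \<in> K" if "x \<in> K" for r x
    using Ksc[OF that, of "of_real r"] by (simp add: scaleC_of_real)
  have Kdiff: "x - y \<in> K" if "x \<in> K" "y \<in> K" for x y
    using Kadd[OF that(1) Ksc'[OF that(2), of "-1"]] by simp
  have co: "A \<in> compact_ops K \<longleftrightarrow> A \<in> carrier (bounded_ops K) \<and> compact (closure (A ` S))" for A
    by (simp add: compact_ops_def S_def)
  have l: "X \<otimes>\<^bsub>bounded_ops K\<^esub> A \<in> compact_ops K"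
    and r: "A \<otimes>\<^bsub>bounded_ops K\<^esub> X \<in> compact_ops K"
    if A: "A \<in> compact_ops K" and X: "X \<in> carrier (bounded_ops K)" for A X
  proof -
    have Ac: "A \<in> carrier (bounded_ops K)" and comp: "compact (closure (A ` S))"
      using A by (auto simp: co)
    from Ac have A1: "\<And>x. x \<in> K \<Longrightarrow> A x \<in> K" "\<And>c x. x \<in> K \<Longrightarrow> A (c *\<^sub>C x) = c *\<^sub>C A x"
      by (auto simp: bounded_ops_def)
    from X have X1: "\<And>x. x \<in> K \<Longrightarrow> X x \<in> K" "\<And>x y. x \<in> K \<Longrightarrow> y \<in> K \<Longrightarrow> X (x + y) = X x + X y"
        "\<And>c x. x \<in> K \<Longrightarrow> X (c *\<^sub>C x) = c *\<^sub>C X x" "\<exists>M. \<forall>x\<in>K. norm (X x) \<le> M * norm x"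
      by (auto simp: bounded_ops_def)
    obtain M0 where M0: "\<And>x. x \<in> K \<Longrightarrow> norm (X x) \<le> M0 * norm x"
      using X1(4) by blast
    define M where "M = \<bar>M0\<bar> + 1"
    have M: "norm (X x) \<le> M * norm x" if "x \<in> K" for x
      by (rule order_trans[OF M0[OF that] mult_right_mono]) (auto simp: M_def)
    have Mpos: "M > 0" by (simp add: M_def add_nonneg_pos)
    have Xd: "X (x - y) = X x - X y" if "x \<in> K" "y \<in> K" for x y
      using X1(2)[OF Kdiff[OF that] that(2)] by (simp add: algebra_simps)
    have lip: "M-lipschitz_on K X"
      using Mpos M Kdiff by (intro lipschitz_onI) (simp_all add: dist_norm flip: Xd)
    have clK: "closure (A ` S) \<subseteq> K"
      by (rule closure_minimal[OF _ cl]) (use A1 S in auto)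
    have "compact (X ` closure (A ` S))"
      using lipschitz_on_continuous_on[OF lip] clK comp
      by (meson compact_continuous_image continuous_on_subset)
    moreover have "(X \<otimes>\<^bsub>bounded_ops K\<^esub> A) ` S \<subseteq> X ` closure (A ` S)"
      using S closure_subset[of "A ` S"] by (auto simp: bounded_ops_def)
    ultimately show "X \<otimes>\<^bsub>bounded_ops K\<^esub> A \<in> compact_ops K"
      using X Ac compact_closure_subset by (simp add: co)
    have "(A \<otimes>\<^bsub>bounded_ops K\<^esub> X) x \<in> (*\<^sub>R) M ` closure (A ` S)" if x: "x \<in> S" for x
    proof -
      have xK: "x \<in> K" and nx: "norm x \<le> 1" using x by (auto simp: S_def)
      define y where "y = inverse M *\<^sub>R X x"
      have "norm (X x) \<le> M"
        using M[OF xK] mult_left_mono[OF nx, of M] Mpos by linarith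
      then have "y \<in> S"
        using Mpos Ksc'[OF X1(1)[OF xK]] by (simp add: S_def y_def field_simps)
      moreover have "A (X x) = M *\<^sub>R A y"
        using A1(2)[OF X1(1)[OF xK], of "of_real (inverse M)"] Mpos
        by (simp only: scaleC_of_real y_def) simp
      ultimately show ?thesis
        using closure_subset[of "A ` S"] xK by (auto simp: bounded_ops_def)
    qed
    then have "(A \<otimes>\<^bsub>bounded_ops K\<^esub> X) ` S \<subseteq> (*\<^sub>R) M ` closure (A ` S)"
      by blast
    moreover have "compact ((*\<^sub>R) M ` closure (A ` S))"
      by (rule compact_scaling[OF comp])
    ultimately show "A \<otimes>\<^bsub>bounded_ops K\<^esub> X \<in> compact_ops K"
      using X Ac compact_closure_subset by (simp add: co)
  qed
  have sub: "subgroup (compact_ops K) (add_monoid (bounded_ops K))"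
  proof (rule subgroup.intro)
    show "compact_ops K \<subseteq> carrier (add_monoid (bounded_ops K))"
      by (auto simp: co)
    show "\<one>\<^bsub>add_monoid (bounded_ops K)\<^esub> \<in> compact_ops K"
    proof -
      have "\<zero>\<^bsub>bounded_ops K\<^esub> ` S \<subseteq> {0}"
        using S by (auto simp: bounded_ops_def)
      then have "compact (closure (\<zero>\<^bsub>bounded_ops K\<^esub> ` S))"
        by (rule compact_closure_subset[rotated]) simp
      then show ?thesis by (simp add: co)
    qed
    fix A assume A: "A \<in> compact_ops K"
    then have Ac: "A \<in> carrier (bounded_ops K)" by (simp add: co)
    have "(\<ominus>\<^bsub>bounded_ops K\<^esub> \<one>\<^bsub>bounded_ops K\<^esub>) \<otimes>\<^bsub>bounded_ops K\<^esub> A \<in> compact_ops K"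
      by (rule l[OF A]) simp
    then have "\<ominus>\<^bsub>bounded_ops K\<^esub> A \<in> compact_ops K"
      using Ac by (simp add: R.l_minus)
    then show "inv\<^bsub>add_monoid (bounded_ops K)\<^esub> A \<in> compact_ops K"
      by (simp only: a_inv_def)
    fix B assume B: "B \<in> compact_ops K"
    have "compact {x + y |x y. x \<in> closure (A ` S) \<and> y \<in> closure (B ` S)}"
      using A B by (intro compact_sums) (auto simp: co)
    moreover have "(A \<oplus>\<^bsub>bounded_ops K\<^esub> B) ` S \<subseteq>
        {x + y |x y. x \<in> closure (A ` S) \<and> y \<in> closure (B ` S)}"
      using S closure_subset[of "A ` S"] closure_subset[of "B ` S"]
      by (fastforce simp: bounded_ops_def)
    ultimately show "A \<otimes>\<^bsub>add_monoid (bounded_ops K)\<^esub> B \<in> compact_ops K"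
      using A B compact_closure_subset by (simp add: co)
  qed
  show ?thesis
    by (rule idealI[OF R.ring_axioms sub]) (simp_all add: l r)
qed

lemma ring_calkin_algebra:
  "csubspace K \<Longrightarrow> closed K \<Longrightarrow> ring (calkin_algebra K)"
  unfolding calkin_algebra_def by (intro ideal.quotient_is_ring ideal_compact_ops)


section \<open>Existence of the full Fock space\<close>

text \<open>A model is built from an orthonormal basis of \<open>'h\<close>, as the space of square-summable
  functions on the words over this basis. It only serves to show that
  \<^const>\<open>full_fock_space\<close> is inhabited for every \<open>'h\<close>.\<close>

definition orthonormal :: "'a::complex_inner set \<Rightarrow> bool" where
  "orthonormal B \<longleftrightarrow> (\<forall>b\<in>B. norm b = 1) \<and> (\<forall>b\<in>B. \<forall>c\<in>B. b \<noteq> c \<longrightarrow> cinner b c = 0)"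

definition orthonormal_basis :: "'a::complex_inner set \<Rightarrow> bool" where
  "orthonormal_basis B \<longleftrightarrow> orthonormal B \<and> (\<forall>x. (\<forall>b\<in>B. cinner x b = 0) \<longrightarrow> x = 0)"

lemma orthonormal_basis_exists: "\<exists>B :: 'a::complex_inner set. orthonormal_basis B"
proof -
  have "\<exists>M\<in>{B :: 'a set. orthonormal B}. \<forall>X\<in>{B. orthonormal B}. M \<subseteq> X \<longrightarrow> X = M"
  proof (rule subset_Zorn', clarsimp)
    fix C :: "'a set set"
    assume C: "subset.chain (Collect orthonormal) C"
    then have on: "\<And>X. X \<in> C \<Longrightarrow> orthonormal X"
      and tot: "\<And>X Y. X \<in> C \<Longrightarrow> Y \<in> C \<Longrightarrow> X \<subseteq> Y \<or> Y \<subseteq> X"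
      by (auto simp: subset_chain_def)
    show "orthonormal (\<Union>C)"
      unfolding orthonormal_def
    proof (intro conjI ballI impI)
      fix b assume "b \<in> \<Union>C"
      then show "norm b = 1" using on by (auto simp: orthonormal_def)
    next
      fix b c assume bc: "b \<in> \<Union>C" "c \<in> \<Union>C" "b \<noteq> c"
      then obtain X Y where "X \<in> C" "b \<in> X" "Y \<in> C" "c \<in> Y" by blast
      then obtain Z where "Z \<in> C" "b \<in> Z" "c \<in> Z" using tot by blast
      then show "cinner b c = 0" using on bc(3) by (auto simp: orthonormal_def)
    qed
  qed
  then obtain M :: "'a set" where M: "orthonormal M"
    and max: "\<And>X. orthonormal X \<Longrightarrow> M \<subseteq> X \<Longrightarrow> X = M"
    by blast
  have "x = 0" if x: "\<forall>b\<in>M. cinner x b = 0" for x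
  proof (rule ccontr)
    assume x0: "x \<noteq> 0"
    define u where "u = of_real (inverse (norm x)) *\<^sub>C x"
    have ub: "cinner u b = 0" "cinner b u = 0" if "b \<in> M" for b
      using x that cinner_commute[of b u] by (auto simp: u_def cinner_scaleC_left)
    have "norm u = 1"
      using x0 by (simp add: u_def norm_scaleC norm_inverse)
    then have "orthonormal (insert u M)"
      using M ub by (auto simp: orthonormal_def)
    then have "insert u M = M" by (rule max) auto
    then have "cinner x u = 0" using x by auto
    then have "cinner x x = 0"
      using x0 by (auto simp: u_def cinner_scaleC_right)
    then show False using x0 by (simp add: cinner_norm)
  qed
  then show ?thesis
    using M by (auto simp: orthonormal_basis_def)
qed

lemma orthonormal_basis_expansion:
  fixes B :: "'a::chilbert_space set"
  assumes B: "orthonormal_basis B"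
  shows "((\<lambda>b. cinner x b *\<^sub>C b) has_sum x) B"
proof -
  have nb: "\<And>b. b \<in> B \<Longrightarrow> norm b = 1"
    and ob: "\<And>b c. b \<in> B \<Longrightarrow> c \<in> B \<Longrightarrow> b \<noteq> c \<Longrightarrow> cinner b c = 0"
    and tb: "\<And>x. (\<forall>b\<in>B. cinner x b = 0) \<Longrightarrow> x = 0"
    using B by (auto simp: orthonormal_basis_def orthonormal_def)
  have bb: "cinner b c = (if b = c then 1 else 0)" if "b \<in> B" "c \<in> B" for b c
    using that nb ob by (auto simp: cinner_norm)
  define f where "f b = cinner x b *\<^sub>C b" for b
  define g where "g b = (cmod (cinner x b))\<^sup>2" for b
  have cf: "cinner y (f b) = cnj (cinner x b) * cinner y b" for y b
    by (simp add: f_def cinner_scaleC_right)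
  have fb: "cinner (sum f F) b = (if b \<in> F then cinner x b else 0)"
    if "finite F" "F \<subseteq> B" "b \<in> B" for F b
  proof -
    have "cinner (sum f F) b = (\<Sum>c\<in>F. if c = b then cinner x c else 0)"
      unfolding cinner_sum_left
      by (rule sum.cong) (use that bb in \<open>auto simp: f_def cinner_scaleC_left\<close>)
    then show ?thesis using that by simp
  qed
  have nf: "(norm (sum f F))\<^sup>2 = sum g F" and xf: "Re (cinner x (sum f F)) = sum g F"
    if "finite F" "F \<subseteq> B" for F
  proof -
    have "cinner (sum f F) (sum f F) = (\<Sum>b\<in>F. cnj (cinner x b) * cinner (sum f F) b)"
      unfolding cinner_sum_right by (simp add: cf)
    also have "\<dots> = (\<Sum>b\<in>F. cinner x b * cnj (cinner x b))"
      by (rule sum.cong[OF refl]) (use that in \<open>simp add: fb subset_iff mult.commute\<close>)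
    also have "\<dots> = of_real (sum g F)"
      by (simp only: g_def complex_norm_square of_real_sum)
    finally show "(norm (sum f F))\<^sup>2 = sum g F"
      by (simp only: cinner_norm of_real_eq_iff)
    have "cinner x (sum f F) = (\<Sum>b\<in>F. cinner x b * cnj (cinner x b))"
      by (simp add: f_def cinner_sum_right cinner_scaleC_right mult.commute)
    also have "\<dots> = of_real (sum g F)"
      by (simp only: g_def complex_norm_square of_real_sum)
    finally show "Re (cinner x (sum f F)) = sum g F"
      by (metis Re_complex_of_real)
  qed
  have bessel: "sum g F \<le> (norm x)\<^sup>2" if "finite F" "F \<subseteq> B" for F
  proof -
    have "Re (cinner x (sum f F)) \<le> norm x * norm (sum f F)"
      using cinner_Cauchy_Schwarz complex_Re_le_cmod order_trans by blast
    then have *: "norm (sum f F) * norm (sum f F) \<le> norm x * norm (sum f F)"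
      using xf[OF that] nf[OF that] by (simp add: power2_eq_square)
    then have "norm (sum f F) \<le> norm x"
      by (cases "norm (sum f F) = 0") (auto simp: mult_le_cancel_right)
    then show ?thesis
      using nf[OF that] by (metis norm_ge_zero power_mono)
  qed
  have g0: "g b \<ge> 0" for b by (simp add: g_def)
  have gs: "g summable_on B"
    using bessel by (intro nonneg_bdd_above_summable_on bdd_aboveI2[where M = "(norm x)\<^sup>2"] g0) auto
  have ex: "\<exists>P. eventually P (finite_subsets_at_top B) \<and>
      (\<forall>F G. P F \<and> P G \<longrightarrow> dist (sum f F) (sum f G) < e)" if e: "e > 0" for e
  proof -
    define d where "d = (e / 3)\<^sup>2"
    have "d > 0" using e by (simp add: d_def)
    then obtain F0 where F0: "finite F0" "F0 \<subseteq> B" "dist (sum g F0) (infsum g B) \<le> d"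
      using has_sum_finite_approximation[OF has_sum_infsum[OF gs]] by blast
    have *: "dist (sum f F) (sum f F0) \<le> e / 3" if F: "finite F" "F0 \<subseteq> F" "F \<subseteq> B" for F
    proof -
      have "(norm (sum f F - sum f F0))\<^sup>2 = (norm (sum f (F - F0)))\<^sup>2"
        using F by (simp add: sum_diff)
      also have "\<dots> = sum g (F - F0)" using F by (intro nf) auto
      also have "\<dots> = sum g F - sum g F0" using F by (simp add: sum_diff)
      also have "\<dots> \<le> d"
        using finite_sum_le_infsum[OF gs F(1,3)] g0 F0(3) by (auto simp: dist_real_def)
      finally show ?thesis
        using e by (simp add: d_def dist_norm power2_le_iff_abs_le)
    qed
    show ?thesis
    proof (intro exI conjI allI impI)
      show "eventually (\<lambda>F. finite F \<and> F0 \<subseteq> F \<and> F \<subseteq> B) (finite_subsets_at_top B)"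
        using F0 by (auto simp: eventually_finite_subsets_at_top)
      fix F G assume FG: "(finite F \<and> F0 \<subseteq> F \<and> F \<subseteq> B) \<and> finite G \<and> F0 \<subseteq> G \<and> G \<subseteq> B"
      have "dist (sum f F) (sum f G) \<le> dist (sum f F) (sum f F0) + dist (sum f G) (sum f F0)"
        by (rule dist_triangle2)
      also have "\<dots> \<le> e / 3 + e / 3"
        using FG by (intro add_mono *) auto
      also have "\<dots> < e" using e by simp
      finally show "dist (sum f F) (sum f G) < e" .
    qed
  qed
  then have "cauchy_filter (filtermap (sum f) (finite_subsets_at_top B))"
    by (simp add: cauchy_filter_metric_filtermap)
  moreover have "complete (UNIV :: 'a set)"
    by (meson Cauchy_convergent UNIV_I complete_def convergent_def)
  ultimately obtain y where "(sum f \<longlongrightarrow> y) (finite_subsets_at_top B)"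
    using complete_uniform[where S = UNIV] by (force simp add: filterlim_def)
  then have y: "(f has_sum y) B"
    by (simp add: has_sum_def)
  have "cinner (x - y) b = 0" if b: "b \<in> B" for b
  proof -
    have "((\<lambda>c. cinner (f c) b) has_sum cinner y b) B"
      by (rule has_sum_bounded_linear[OF bounded_linear_cinner_left y])
    moreover have "((\<lambda>c. cinner (f c) b) has_sum cinner x b) B"
      by (rule has_sum_finite_neutralI[of "{b}"])
        (use b bb in \<open>auto simp: f_def cinner_scaleC_left\<close>)
    ultimately show ?thesis
      by (simp add: cinner_diff_left has_sum_unique)
  qed
  then have "x - y = 0" using tb by blast
  then show ?thesis using y by (simp add: f_def[abs_def])
qed

lemma orthonormal_basis_Parseval:
  fixes B :: "'a::chilbert_space set"
  assumes "orthonormal_basis B"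
  shows "((\<lambda>b. cinner x b * cnj (cinner y b)) has_sum cinner x y) B"
proof -
  have "((\<lambda>b. cinner (cinner x b *\<^sub>C b) y) has_sum cinner x y) B"
    by (rule has_sum_bounded_linear[OF bounded_linear_cinner_left orthonormal_basis_expansion[OF assms]])
  then show ?thesis
    by (simp add: cinner_scaleC_left flip: cinner_commute)
qed

definition hbasis :: "'h::chilbert_space set" where
  "hbasis = (SOME B. orthonormal_basis B)"

lemma hbasis: "orthonormal_basis hbasis"
  unfolding hbasis_def by (rule someI_ex[OF orthonormal_basis_exists])

lemma cinner_hbasis: "a \<in> hbasis \<Longrightarrow> b \<in> hbasis \<Longrightarrow> cinner a b = (if a = b then 1 else 0)"
  using hbasis by (auto simp: orthonormal_basis_def orthonormal_def cinner_norm)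


definition square_summable :: "('i \<Rightarrow> complex) \<Rightarrow> bool" where
  "square_summable f \<longleftrightarrow> (\<lambda>i. (cmod (f i))\<^sup>2) summable_on UNIV"

definition l2norm :: "('i \<Rightarrow> complex) \<Rightarrow> real" where
  "l2norm f = sqrt (infsum (\<lambda>i. (cmod (f i))\<^sup>2) UNIV)"

lemma L2_set_le_l2norm:
  assumes "square_summable f" "finite F"
  shows "L2_set (\<lambda>i. cmod (f i)) F \<le> l2norm f"
  unfolding L2_set_def l2norm_def
  using assms by (intro real_sqrt_le_mono finite_sum_le_infsum) (auto simp: square_summable_def)

lemma l2norm_bound:
  assumes "\<And>F. finite F \<Longrightarrow> L2_set (\<lambda>i. cmod (f i)) F \<le> C"
  shows "square_summable f" and "l2norm f \<le> C"
proof -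
  have C: "C \<ge> 0" using assms[of "{}"] by simp
  have *: "(\<Sum>i\<in>F. (cmod (f i))\<^sup>2) \<le> C\<^sup>2" if "finite F" for F
    using assms[OF that] C by (simp add: L2_set_def real_sqrt_le_iff real_le_lsqrt sqrt_le_D)
  show ss: "square_summable f"
    unfolding square_summable_def
    using * by (intro nonneg_bdd_above_summable_on bdd_aboveI2[where M = "C\<^sup>2"]) auto
  have "infsum (\<lambda>i. (cmod (f i))\<^sup>2) UNIV \<le> C\<^sup>2"
    using ss * by (intro infsum_le_finite_sums) (auto simp: square_summable_def)
  then show "l2norm f \<le> C"
    using C by (simp add: l2norm_def real_le_lsqrt)
qed

lemma l2norm_nonneg: "0 \<le> l2norm f"
  by (simp add: l2norm_def infsum_nonneg)

lemma l2norm_add: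
  assumes f: "square_summable f" and g: "square_summable g"
  shows "square_summable (\<lambda>i. f i + g i)" and "l2norm (\<lambda>i. f i + g i) \<le> l2norm f + l2norm g"
proof -
  have *: "L2_set (\<lambda>i. cmod (f i + g i)) F \<le> l2norm f + l2norm g" if "finite F" for F
  proof -
    have "L2_set (\<lambda>i. cmod (f i + g i)) F \<le> L2_set (\<lambda>i. cmod (f i) + cmod (g i)) F"
      by (intro L2_set_mono norm_triangle_ineq) auto
    also have "\<dots> \<le> L2_set (\<lambda>i. cmod (f i)) F + L2_set (\<lambda>i. cmod (g i)) F"
      by (rule L2_set_triangle_ineq)
    finally show ?thesis
      using L2_set_le_l2norm[OF f that] L2_set_le_l2norm[OF g that] by linarith
  qed
  show "square_summable (\<lambda>i. f i + g i)"
    by (rule l2norm_bound(1)[OF *])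
  show "l2norm (\<lambda>i. f i + g i) \<le> l2norm f + l2norm g"
    by (rule l2norm_bound(2)[OF *])
qed

lemma l2norm_scale:
  shows "square_summable f \<Longrightarrow> square_summable (\<lambda>i. c * f i)"
    and "l2norm (\<lambda>i. c * f i) = cmod c * l2norm f"
  by (simp_all add: square_summable_def l2norm_def norm_mult power_mult_distrib
      summable_on_cmult_right infsum_cmult_right' real_sqrt_mult)

lemma l2norm_eq_0D:
  assumes "square_summable f" "l2norm f = 0"
  shows "f i = 0"
  using L2_set_le_l2norm[OF assms(1), of "{i}"] assms(2) by simp

lemma square_summable_prod:
  assumes "square_summable f" "square_summable g"
  shows "(\<lambda>i. f i * cnj (g i)) summable_on UNIV"
  by (rule abs_summable_summable, rule abs_summable_product)
    (use assms in \<open>simp_all add: square_summable_def norm_mult power2_eq_square\<close>)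

typedef (overloaded) 'h fock = "{u :: 'h::chilbert_space list \<Rightarrow> complex.
    square_summable u \<and> (\<forall>w. \<not> set w \<subseteq> hbasis \<longrightarrow> u w = 0)}"
  by (rule exI[of _ "\<lambda>_. 0"]) (simp add: square_summable_def)

lemma Rep_fock_ss: "square_summable (Rep_fock u)"
  and Rep_fock_supp: "\<not> set w \<subseteq> hbasis \<Longrightarrow> Rep_fock u w = 0"
  using Rep_fock[of u] by auto

lemma fock_eqI: "(\<And>w. Rep_fock u w = Rep_fock v w) \<Longrightarrow> u = v"
  by (simp add: fun_eq_iff flip: Rep_fock_inject)

instantiation fock :: (chilbert_space) complex_inner
begin

definition "0 = Abs_fock (\<lambda>_. 0)"
definition "u + v = Abs_fock (\<lambda>w. Rep_fock u w + Rep_fock v w)"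
definition "c *\<^sub>C u = Abs_fock (\<lambda>w. c * Rep_fock u w)"
definition "r *\<^sub>R (u :: 'a fock) = of_real r *\<^sub>C u"
definition "- (u :: 'a fock) = (-1) *\<^sub>C u"
definition "u - (v :: 'a fock) = u + (- v)"
definition "cinner u v = infsum (\<lambda>w. Rep_fock u w * cnj (Rep_fock v w)) UNIV"
definition "norm u = l2norm (Rep_fock u)"
definition "sgn (u :: 'a fock) = inverse (norm u) *\<^sub>R u"
definition "dist u (v :: 'a fock) = norm (u - v)"
definition [code del]:
  "uniformity = (INF e\<in>{0<..}. principal {(u :: 'a fock, v). dist u v < e})"
definition [code del]:
  "open (U :: 'a fock set) \<longleftrightarrow> (\<forall>u\<in>U. eventually (\<lambda>(u', v). u' = u \<longrightarrow> v \<in> U) uniformity)"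

lemma Rep_fock_zero: "Rep_fock 0 w = 0"
  by (simp add: zero_fock_def Abs_fock_inverse square_summable_def)

lemma Rep_fock_plus: "Rep_fock (u + v) w = Rep_fock u w + Rep_fock v w"
  by (simp add: plus_fock_def Abs_fock_inverse l2norm_add Rep_fock_ss Rep_fock_supp)

lemma Rep_fock_scaleC: "Rep_fock (c *\<^sub>C u) w = c * Rep_fock u w"
  by (simp add: scaleC_fock_def Abs_fock_inverse l2norm_scale Rep_fock_ss Rep_fock_supp)

lemma Rep_fock_scaleR: "Rep_fock (r *\<^sub>R u) w = of_real r * Rep_fock u w"
  by (simp add: scaleR_fock_def Rep_fock_scaleC)

lemma Rep_fock_uminus: "Rep_fock (- u) w = - Rep_fock u w"
  by (simp add: uminus_fock_def Rep_fock_scaleC)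

lemma Rep_fock_minus: "Rep_fock (u - v) w = Rep_fock u w - Rep_fock v w"
  by (simp add: minus_fock_def Rep_fock_plus Rep_fock_uminus)

lemmas Rep_fock_simps = Rep_fock_zero Rep_fock_plus Rep_fock_scaleC Rep_fock_scaleR
  Rep_fock_uminus Rep_fock_minus

instance
proof
  fix u v w :: "'a fock" and r s :: real and c d :: complex and U :: "'a fock set"
  show "u + v + w = u + (v + w)" "u + v = v + u" "0 + u = u" "- u + u = 0" "u - v = u + - v"
    "r *\<^sub>R (u + v) = r *\<^sub>R u + r *\<^sub>R v" "(r + s) *\<^sub>R u = r *\<^sub>R u + s *\<^sub>R u"
    "r *\<^sub>R s *\<^sub>R u = (r * s) *\<^sub>R u" "1 *\<^sub>R u = u"
    "c *\<^sub>C (u + v) = c *\<^sub>C u + c *\<^sub>C v" "(c + d) *\<^sub>C u = c *\<^sub>C u + d *\<^sub>C u"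
    "c *\<^sub>C d *\<^sub>C u = (c * d) *\<^sub>C u" "of_real r *\<^sub>C u = r *\<^sub>R u"
    by (rule fock_eqI; simp add: Rep_fock_simps algebra_simps)+
  show "dist u v = norm (u - v)" by (rule dist_fock_def)
  show "sgn u = inverse (norm u) *\<^sub>R u" by (rule sgn_fock_def)
  show "uniformity = (INF e\<in>{0<..}. principal {(u :: 'a fock, v). dist u v < e})"
    by (rule uniformity_fock_def)
  show "open U \<longleftrightarrow> (\<forall>u\<in>U. eventually (\<lambda>(u', v). u' = u \<longrightarrow> v \<in> U) uniformity)"
    by (rule open_fock_def)
  show "norm u = 0 \<longleftrightarrow> u = 0"
  proof
    assume "norm u = 0"
    then have "Rep_fock u w = 0" for w
      using l2norm_eq_0D[OF Rep_fock_ss] by (simp add: norm_fock_def)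
    then show "u = 0" by (intro fock_eqI) (simp add: Rep_fock_zero)
  qed (simp add: norm_fock_def l2norm_def Rep_fock_zero)
  show "norm (u + v) \<le> norm u + norm v"
    using l2norm_add(2)[OF Rep_fock_ss Rep_fock_ss, of u v]
    by (simp add: norm_fock_def Rep_fock_plus[abs_def])
  show "norm (r *\<^sub>R u) = \<bar>r\<bar> * norm u"
    by (simp add: norm_fock_def Rep_fock_scaleR[abs_def] l2norm_scale(2))
  note sm = square_summable_prod[OF Rep_fock_ss Rep_fock_ss]
  show "cinner (u + v) w = cinner u w + cinner v w"
    by (simp add: cinner_fock_def Rep_fock_plus distrib_right infsum_add sm)
  show "cinner (c *\<^sub>C u) v = c * cinner u v"
    by (simp add: cinner_fock_def Rep_fock_scaleC mult.assoc infsum_cmult_right')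
  show "cinner u v = cnj (cinner v u)"
    by (simp add: cinner_fock_def mult.commute flip: infsum_cnj)
  have "cinner u u = infsum (\<lambda>w. of_real ((cmod (Rep_fock u w))\<^sup>2)) UNIV"
    by (simp only: cinner_fock_def complex_norm_square)
  also have "\<dots> = of_real (infsum (\<lambda>w. (cmod (Rep_fock u w))\<^sup>2) UNIV)"
    using Rep_fock_ss[of u] by (intro infsumI has_sum_of_real has_sum_infsum) (simp add: square_summable_def)
  also have "\<dots> = of_real ((norm u)\<^sup>2)"
    by (simp add: norm_fock_def l2norm_def infsum_nonneg)
  finally show "cinner u u = of_real ((norm u)\<^sup>2)" .
qed

end

instance fock :: (chilbert_space) chilbert_space
proof
  fix X :: "nat \<Rightarrow> 'a fock"
  assume X: "Cauchy X"
  have L2: "L2_set (\<lambda>w. cmod (Rep_fock (X m) w - Rep_fock (X n) w)) F \<le> dist (X m) (X n)"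
    if "finite F" for m n F
    using L2_set_le_l2norm[OF Rep_fock_ss that, of "X m - X n"]
    by (simp add: dist_norm norm_fock_def Rep_fock_minus[abs_def])
  have L1: "dist (Rep_fock (X m) w) (Rep_fock (X n) w) \<le> dist (X m) (X n)" for m n w
    using L2[of "{w}" m n] by (simp add: dist_norm)
  have "Cauchy (\<lambda>n. Rep_fock (X n) w)" for w
  proof (rule metric_CauchyI)
    fix e :: real assume "e > 0"
    then obtain N where "\<forall>m\<ge>N. \<forall>n\<ge>N. dist (X m) (X n) < e"
      using X metric_CauchyD by blast
    then show "\<exists>N. \<forall>m\<ge>N. \<forall>n\<ge>N. dist (Rep_fock (X m) w) (Rep_fock (X n) w) < e"
      by (meson L1 le_less_trans)
  qed
  then have "\<exists>l. (\<lambda>n. Rep_fock (X n) w) \<longlonglongrightarrow> l" for w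
    using Cauchy_convergent convergent_def by blast
  then obtain f where f: "\<And>w. (\<lambda>n. Rep_fock (X n) w) \<longlonglongrightarrow> f w"
    by metis
  have lim: "\<exists>N. \<forall>n\<ge>N. \<forall>F. finite F \<longrightarrow> L2_set (\<lambda>w. cmod (Rep_fock (X n) w - f w)) F \<le> e"
    if "e > 0" for e
  proof -
    obtain N where N: "\<forall>m\<ge>N. \<forall>n\<ge>N. dist (X m) (X n) < e"
      using X \<open>e > 0\<close> metric_CauchyD by blast
    have "L2_set (\<lambda>w. cmod (Rep_fock (X n) w - f w)) F \<le> e" if "n \<ge> N" "finite F" for n F
    proof (rule tendsto_upperbound)
      show "(\<lambda>m. L2_set (\<lambda>w. cmod (Rep_fock (X n) w - Rep_fock (X m) w)) F)
          \<longlonglongrightarrow> L2_set (\<lambda>w. cmod (Rep_fock (X n) w - f w)) F"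
        unfolding L2_set_def by (intro tendsto_intros f)
      show "\<forall>\<^sub>F m in sequentially. L2_set (\<lambda>w. cmod (Rep_fock (X n) w - Rep_fock (X m) w)) F \<le> e"
        using N L2[OF that(2), of n] that(1)
        by (intro eventually_sequentiallyI[of N]) (meson less_imp_le order_trans)
    qed simp
    then show ?thesis by blast
  qed
  have supp: "f w = 0" if "\<not> set w \<subseteq> hbasis" for w
    using f[of w] that by (simp add: Rep_fock_supp LIMSEQ_const_iff)
  obtain N where "\<forall>F. finite F \<longrightarrow> L2_set (\<lambda>w. cmod (Rep_fock (X N) w - f w)) F \<le> 1"
    using lim[of 1] by auto
  then have "square_summable (\<lambda>w. Rep_fock (X N) w - f w)"
    by (intro l2norm_bound(1)) auto
  then have "square_summable (\<lambda>w. Rep_fock (X N) w + (-1) * (Rep_fock (X N) w - f w))"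
    by (intro l2norm_add(1) l2norm_scale(1) Rep_fock_ss)
  then have "square_summable f" by simp
  then have Rf: "Rep_fock (Abs_fock f) = f"
    using supp by (simp add: Abs_fock_inverse)
  have "X \<longlonglongrightarrow> Abs_fock f"
  proof (rule metric_LIMSEQ_I)
    fix e :: real assume "e > 0"
    then obtain N where N: "\<forall>n\<ge>N. \<forall>F. finite F \<longrightarrow> L2_set (\<lambda>w. cmod (Rep_fock (X n) w - f w)) F \<le> e / 2"
      using lim[of "e / 2"] by auto
    have "dist (X n) (Abs_fock f) < e" if "n \<ge> N" for n
    proof -
      have "l2norm (\<lambda>w. Rep_fock (X n) w - f w) \<le> e / 2"
        using N that by (intro l2norm_bound(2)) auto
      then show ?thesis
        using \<open>e > 0\<close> by (simp add: dist_norm norm_fock_def Rep_fock_minus[abs_def] Rf)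
    qed
    then show "\<exists>N. \<forall>n\<ge>N. dist (X n) (Abs_fock f) < e" by blast
  qed
  then show "convergent X" by (rule convergentI)
qed

fun tens_coeff :: "'h::chilbert_space list \<Rightarrow> 'h list \<Rightarrow> complex" where
  "tens_coeff [] [] = 1"
| "tens_coeff (x # xs) (b # w) = (if b \<in> hbasis then cinner x b * tens_coeff xs w else 0)"
| "tens_coeff _ _ = 0"

definition fock_tens :: "'h::chilbert_space list \<Rightarrow> 'h fock" where
  "fock_tens xs = Abs_fock (tens_coeff xs)"

lemma tens_coeff_length: "length xs \<noteq> length w \<Longrightarrow> tens_coeff xs w = 0"
  by (induction xs w rule: tens_coeff.induct) auto

lemma tens_coeff_supp: "\<not> set w \<subseteq> hbasis \<Longrightarrow> tens_coeff xs w = 0"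
  by (induction xs w rule: tens_coeff.induct) auto

lemma tens_coeff_hbasis: "set xs \<subseteq> hbasis \<Longrightarrow> tens_coeff xs w = (if w = xs then 1 else 0)"
  by (induction xs w rule: tens_coeff.induct) (auto simp: cinner_hbasis)

lemma tens_coeff_add:
  "tens_coeff (xs @ (x + y) # ys) w = tens_coeff (xs @ x # ys) w + tens_coeff (xs @ y # ys) w"
proof (induction xs arbitrary: w)
  case Nil
  then show ?case by (cases w) (auto simp: cinner_add_left algebra_simps)
next
  case (Cons a xs)
  then show ?case by (cases w) (auto simp: algebra_simps)
qed

lemma tens_coeff_scaleC:
  "tens_coeff (xs @ (c *\<^sub>C x) # ys) w = c * tens_coeff (xs @ x # ys) w"
proof (induction xs arbitrary: w)
  case Nil
  then show ?case by (cases w) (auto simp: cinner_scaleC_left algebra_simps)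
next
  case (Cons a xs)
  then show ?case by (cases w) (auto simp: algebra_simps)
qed

lemma tens_coeff_has_sum:
  assumes "length xs = length ys"
  shows "((\<lambda>w. tens_coeff xs w * cnj (tens_coeff ys w)) has_sum
      (\<Prod>i<length xs. cinner (xs ! i) (ys ! i))) UNIV"
  using assms
proof (induction xs ys rule: list_induct2)
  case Nil
  have "tens_coeff [] w = 0" if "w \<noteq> []" for w :: "'a list"
    using that by (cases w) auto
  then show ?case
    by (intro has_sum_finite_neutralI[of "{[]}"]) auto
next
  case (Cons x xs y ys)
  define p where "p b = cinner x b * cnj (cinner y b)" for b
  define q where "q w = tens_coeff xs w * cnj (tens_coeff ys w)" for w
  have p: "(p has_sum cinner x y) hbasis"
    unfolding p_def by (rule orthonormal_basis_Parseval[OF hbasis])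
  have q: "(q has_sum (\<Prod>i<length xs. cinner (xs ! i) (ys ! i))) UNIV" (is "(q has_sum ?Q) UNIV")
    unfolding q_def by (rule Cons.IH)
  have pa: "(\<lambda>b. norm (p b)) summable_on hbasis" and qa: "(\<lambda>w. norm (q w)) summable_on UNIV"
    using p q has_sum_imp_summable summable_on_iff_abs_summable_on_complex by blast+
  have "(\<lambda>z. norm (case z of (b, w) \<Rightarrow> p b * q w)) summable_on hbasis \<times> UNIV"
    unfolding Infinite_Sum.abs_summable_on_Sigma_iff
    using pa qa
    by (auto simp: norm_mult infsum_cmult_right' infsum_nonneg abs_mult
        intro!: summable_on_cmult_right summable_on_cmult_left)
  then have "(\<lambda>(b, w). p b * q w) summable_on hbasis \<times> UNIV"
    by (rule abs_summable_summable)
  then have *: "((\<lambda>(b, w). p b * q w) has_sum cinner x y * ?Q) (hbasis \<times> UNIV)"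
    using has_sum_cmult_right[OF q] has_sum_cmult_left[OF p, of ?Q]
    by (intro has_sum_SigmaI[where g = "\<lambda>b. p b * ?Q"]) auto
  let ?h = "\<lambda>(b, w). b # w" and ?r = "\<lambda>w. tens_coeff (x # xs) w * cnj (tens_coeff (y # ys) w)"
  have "inj_on ?h (hbasis \<times> UNIV)"
    by (auto simp: inj_on_def)
  moreover have "((?r \<circ> ?h) has_sum cinner x y * ?Q) (hbasis \<times> UNIV)"
    using * by (rule has_sum_cong[THEN iffD1, rotated]) (auto simp: p_def q_def)
  ultimately have "(?r has_sum cinner x y * ?Q) (?h ` (hbasis \<times> UNIV))"
    using has_sum_reindex by blast
  moreover have "?r w = 0" if "w \<in> UNIV - ?h ` (hbasis \<times> UNIV)" for w
    using that by (cases w) auto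
  ultimately have "(?r has_sum cinner x y * ?Q) UNIV"
    by (subst (asm) has_sum_cong_neutral[where T = UNIV and g = ?r]) auto
  then show ?case
    by (simp add: prod.lessThan_Suc_shift o_def del: prod.lessThan_Suc)
qed

lemma Rep_fock_tens: "Rep_fock (fock_tens xs) = tens_coeff xs"
proof -
  have "(\<lambda>w. tens_coeff xs w * cnj (tens_coeff xs w)) summable_on UNIV"
    using tens_coeff_has_sum[of xs xs] by (auto simp: summable_on_def)
  then have "(\<lambda>w. of_real ((cmod (tens_coeff xs w))\<^sup>2) :: complex) summable_on UNIV"
    by (simp only: complex_norm_square)
  then have "square_summable (tens_coeff xs)"
    unfolding square_summable_def by (drule_tac summable_on_Re) simp
  then show ?thesis
    by (simp add: fock_tens_def Abs_fock_inverse tens_coeff_supp)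
qed

lemma fock_tens_dense: "closure (cspan (range fock_tens)) = (UNIV :: 'h::chilbert_space fock set)"
proof -
  have "\<exists>v\<in>cspan (range fock_tens). dist v u < e" if "e > 0" for u :: "'h fock" and e
  proof -
    define g where "g w = (cmod (Rep_fock u w))\<^sup>2" for w
    have gs: "g summable_on UNIV"
      using Rep_fock_ss[of u] by (simp add: square_summable_def g_def[abs_def])
    have "(e / 2)\<^sup>2 > 0" using that by simp
    then obtain F where F: "finite F" "dist (sum g F) (infsum g UNIV) \<le> (e / 2)\<^sup>2"
      using has_sum_finite_approximation[OF has_sum_infsum[OF gs]] by blast
    define G where "G = {w \<in> F. set w \<subseteq> hbasis}"
    define v where "v = (\<Sum>w\<in>G. Rep_fock u w *\<^sub>C fock_tens w)"
    have G: "finite G" using F by (simp add: G_def)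
    have Rsum: "Rep_fock (sum f S) w = (\<Sum>i\<in>S. Rep_fock (f i) w)"
      for f :: "'h list \<Rightarrow> 'h fock" and S w
      by (induction S rule: infinite_finite_induct) (auto simp: Rep_fock_simps)
    have Rv: "Rep_fock v w = (if w \<in> F then Rep_fock u w else 0)" for w
    proof -
      have "Rep_fock v w = (\<Sum>w'\<in>G. if w = w' then Rep_fock u w' else 0)"
        unfolding v_def Rsum
        by (rule sum.cong) (auto simp: Rep_fock_simps Rep_fock_tens tens_coeff_hbasis G_def)
      then show ?thesis
        using G by (auto simp: G_def Rep_fock_supp)
    qed
    have "L2_set (\<lambda>w. cmod (Rep_fock (v - u) w)) H \<le> e / 2" if "finite H" for H
    proof -
      have "(\<Sum>w\<in>H. (cmod (Rep_fock (v - u) w))\<^sup>2) = (\<Sum>w\<in>H. if w \<in> F then 0 else g w)"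
        by (rule sum.cong) (auto simp: Rep_fock_minus Rv g_def)
      also have "\<dots> = sum g (H - F)"
        using that by (simp add: sum.If_cases Diff_eq)
      also have "\<dots> = sum g (F \<union> H) - sum g F"
        using that F(1) by (subst sum_diff[symmetric]) (auto intro!: sum.cong)
      also have "\<dots> \<le> infsum g UNIV - sum g F"
        using that F(1) finite_sum_le_infsum[OF gs, of "F \<union> H"] by (simp add: g_def)
      also have "\<dots> \<le> (e / 2)\<^sup>2"
        using F(2) by (simp add: dist_real_def)
      finally show ?thesis
        unfolding L2_set_def using \<open>e > 0\<close> by (intro real_le_lsqrt) auto
    qed
    then have "dist v u \<le> e / 2"
      unfolding dist_norm norm_fock_def by (rule l2norm_bound(2))
    moreover have "v \<in> cspan (range fock_tens)"
      unfolding v_def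
      by (intro complex_vector.span_sum complex_vector.span_scale complex_vector.span_base) auto
    ultimately show ?thesis
      using \<open>e > 0\<close> by (intro bexI[of _ v]) auto
  qed
  then show ?thesis
    by (auto simp: closure_approachable)
qed

theorem full_fock_space_exists: "full_fock_space (fock_tens :: 'h::chilbert_space list \<Rightarrow> 'h fock)"
  unfolding full_fock_space_def
proof (intro conjI allI impI fock_tens_dense)
  fix xs ys :: "'h list" and x y :: 'h and c :: complex
  show "fock_tens (xs @ (x + y) # ys) = fock_tens (xs @ x # ys) + fock_tens (xs @ y # ys)"
    by (rule fock_eqI) (simp add: Rep_fock_simps Rep_fock_tens tens_coeff_add)
  show "fock_tens (xs @ (c *\<^sub>C x) # ys) = c *\<^sub>C fock_tens (xs @ x # ys)"
    by (rule fock_eqI) (simp add: Rep_fock_simps Rep_fock_tens tens_coeff_scaleC)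
  show "cinner (fock_tens xs) (fock_tens ys) = (\<Prod>i<length xs. cinner (xs ! i) (ys ! i))"
    if "length xs = length ys"
    using tens_coeff_has_sum[OF that] by (simp add: cinner_fock_def Rep_fock_tens infsumI)
  show "cinner (fock_tens xs) (fock_tens ys) = 0" if "length xs \<noteq> length ys"
  proof -
    have "tens_coeff xs w * cnj (tens_coeff ys w) = 0" for w
      using that by (cases "length xs = length w") (auto simp: tens_coeff_length)
    then show ?thesis
      unfolding cinner_fock_def Rep_fock_tens by (rule infsum_0)
  qed
qed

end

theory Submission
  imports Defs
begin

text \<open>
  Write \<open>T = A + i B\<close> with the self-adjoint field operators \<open>A = l(v\<^sub>1) + l(v\<^sub>1)\<^sup>*\<close> and
  \<open>B = r(v\<^sub>2) + r(v\<^sub>2)\<^sup>*\<close>, and call the rectangle \<open>Q\<close>. The theorem follows from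
  \<open>\<sigma>(T) \<subseteq> Q \<subseteq> \<sigma>\<^sub>e(T) \<subseteq> \<sigma>(T)\<close>, where the last inclusion holds because the quotient map to the Calkin
  algebra preserves invertibility.

  The first inclusion comes from the numerical range: \<open>\<langle>T x, x\<rangle> = \<langle>A x, x\<rangle> + i \<langle>B x, x\<rangle>\<close> has real and
  imaginary part bounded by \<open>\<Parallel>A\<Parallel> \<le> 2\<Parallel>v\<^sub>1\<Parallel>\<close> and \<open>\<Parallel>B\<Parallel> \<le> 2\<Parallel>v\<^sub>2\<Parallel>\<close>, and a coercive operator is invertible
  (\<open>coercive_imp_bij_betw\<close>).

  For the second inclusion, let \<open>w \<noteq> 0\<close> be the component of \<open>v\<^sub>2\<close> orthogonal to \<open>v\<^sub>1\<close>. The normalised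
  tensors \<open>g(n, m)\<close> of \<open>n\<close> factors \<open>v\<^sub>1\<close>, one factor \<open>w\<close> and \<open>m\<close> factors \<open>v\<^sub>2\<close>, in this order, are an
  orthonormal system in the cyclic subspace. Away from the edges of the quarter-plane of indices,
  \<open>A g(n, m) = \<Parallel>v\<^sub>1\<Parallel> (g(n + 1, m) + g(n - 1, m))\<close> and
  \<open>B g(n, m) = \<Parallel>v\<^sub>2\<Parallel> (g(n, m + 1) + g(n, m - 1))\<close>, since \<open>A\<close> acts on the left end of a
  tensor and \<open>B\<close> on the right end. So \<open>A\<close> and \<open>B\<close> are discrete Laplacians in two independent
  directions, and the plane waves with coefficients \<open>\<omega>\<^sup>n \<psi>\<^sup>m\<close>, where \<open>\<omega> = exp(i\<theta>)\<close> and
  \<open>\<psi> = exp(i\<phi>)\<close>, are formal common eigenvectors, with the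
  eigenvalues \<open>2\<Parallel>v\<^sub>1\<Parallel> cos \<theta>\<close> and \<open>2\<Parallel>v\<^sub>2\<Parallel> cos \<phi>\<close>. Cut off to larger and larger disjoint squares, they
  give an orthonormal sequence \<open>x\<^sub>k\<close> with \<open>(T - z) x\<^sub>k \<longrightarrow> 0\<close> for any prescribed \<open>z \<in> Q\<close>
  (\<open>wave_packet_Weyl_sequence\<close>). Such a sequence rules out that \<open>T - z\<close> is invertible modulo compact
  operators (\<open>orthonormal_Weyl_sequence_imp_essential_spectrum\<close>).
\<close>

section \<open>Bounded complex-linear maps\<close>

lemma bounded_clinearI:
  assumes "\<And>x y. A (x + y) = A x + A y" and "\<And>c x. A (c *\<^sub>C x) = c *\<^sub>C A x"
    and "\<And>x. norm (A x) \<le> M * norm x"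
  shows "bounded_clinear A"
  unfolding bounded_clinear_def
proof (intro conjI allI)
  show "bounded_linear A"
    by (rule bounded_linear_intro[where K = M])
      (use assms in \<open>simp_all add: scaleC_of_real[symmetric] mult.commute\<close>)
qed (rule assms)

lemma bounded_clinearD:
  assumes "bounded_clinear A"
  shows "bounded_linear A" and "A (x + y) = A x + A y" and "A (c *\<^sub>C x) = c *\<^sub>C A x"
    and "A (x - y) = A x - A y" and "A 0 = 0" and "A (sum f S) = (\<Sum>i\<in>S. A (f i))"
proof -
  show bl: "bounded_linear A" and "A (c *\<^sub>C x) = c *\<^sub>C A x"
    using assms by (auto simp: bounded_clinear_def)
  interpret bounded_linear A by (rule bl)
  show "A (x + y) = A x + A y" "A (x - y) = A x - A y" "A 0 = 0"
    "A (sum f S) = (\<Sum>i\<in>S. A (f i))"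
    by (rule add diff zero sum)+
qed

lemma bounded_clinear_bound:
  assumes "bounded_clinear A"
  obtains M where "M > 0" and "\<And>x. norm (A x) \<le> M * norm x"
  using bounded_linear.pos_bounded[OF bounded_clinearD(1)[OF assms]] by (metis mult.commute)

lemma bounded_clinear_scaleC: "bounded_clinear ((*\<^sub>C) c :: 'a::complex_inner \<Rightarrow> 'a)"
  by (rule bounded_clinearI[where M = "cmod c"])
    (auto simp: norm_scaleC complex_vector.scale_right_distrib mult.commute)

lemma bounded_clinear_add:
  assumes "bounded_clinear A" and "bounded_clinear B"
  shows "bounded_clinear (\<lambda>x. A x + B x)"
  using assms
  by (auto simp: bounded_clinear_def bounded_linear_add complex_vector.scale_right_distrib)

lemma bounded_clinear_scale:
  assumes "bounded_clinear A"
  shows "bounded_clinear (\<lambda>x. c *\<^sub>C A x)"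
  unfolding bounded_clinear_def
proof (intro conjI allI)
  show "bounded_linear (\<lambda>x. c *\<^sub>C A x)"
    by (rule bounded_linear_compose[OF bounded_clinearD(1)[OF bounded_clinear_scaleC]
          bounded_clinearD(1)[OF assms]])
qed (simp add: bounded_clinearD(3)[OF assms] mult.commute)

lemma bounded_linear_cinner_right: "bounded_linear (\<lambda>y. cinner x y)"
  for x :: "'a::complex_inner"
proof -
  have "bounded_linear (\<lambda>y. cnj (cinner y x))"
    by (rule bounded_linear_compose[OF bounded_linear_cnj bounded_linear_cinner_left])
  then show ?thesis by (simp flip: cinner_commute)
qed

lemma csubspace_closure:
  fixes S :: "'a::complex_inner set"
  assumes S: "csubspace S"
  shows "csubspace (closure S)"
  unfolding complex_vector.subspace_def
proof (intro conjI ballI allI)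
  show "0 \<in> closure S"
    using complex_vector.subspace_0[OF S] closure_subset by blast
next
  fix x y assume "x \<in> closure S" "y \<in> closure S"
  then obtain X Y where "\<And>n. X n \<in> S" "X \<longlonglongrightarrow> x" "\<And>n. Y n \<in> S" "Y \<longlonglongrightarrow> y"
    by (auto simp: closure_sequential)
  then show "x + y \<in> closure S"
    unfolding closure_sequential
    by (intro exI[of _ "\<lambda>n. X n + Y n"]) (auto intro: tendsto_add complex_vector.subspace_add[OF S])
next
  fix c x assume "x \<in> closure S"
  then have "c *\<^sub>C x \<in> closure ((*\<^sub>C) c ` S)"
    using closure_bounded_linear_image_subset[OF bounded_clinearD(1)[OF bounded_clinear_scaleC]]
    by blast
  also have "\<dots> \<subseteq> closure S"
    by (intro closure_mono) (auto intro: complex_vector.subspace_scale[OF S])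
  finally show "c *\<^sub>C x \<in> closure S" .
qed

lemma closed_csubspace_total_family:
  fixes p :: "'i \<Rightarrow> 'a::complex_inner"
  assumes dense: "closure (cspan (range p)) = UNIV"
    and S: "csubspace S" "closed S" and p: "\<And>i. p i \<in> S"
  shows "x \<in> S"
proof -
  have "cspan (range p) \<subseteq> S"
    by (rule complex_vector.span_minimal[OF _ S(1)]) (use p in auto)
  then have "closure (cspan (range p)) \<subseteq> S"
    by (rule closure_minimal[OF _ S(2)])
  then show ?thesis using dense by auto
qed

lemma bounded_clinear_eqI:
  fixes p :: "'i \<Rightarrow> 'a::complex_inner" and A B :: "'a \<Rightarrow> 'b::complex_inner"
  assumes dense: "closure (cspan (range p)) = UNIV"
    and AB: "bounded_clinear A" "bounded_clinear B" and eq: "\<And>i. A (p i) = B (p i)"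
  shows "A = B"
proof
  fix x
  have "x \<in> {x. A x = B x}"
  proof (rule closed_csubspace_total_family[OF dense])
    show "csubspace {x. A x = B x}"
      by (auto simp: complex_vector.subspace_def AB[THEN bounded_clinearD(5)]
          AB[THEN bounded_clinearD(2)] AB[THEN bounded_clinearD(3)])
    show "closed {x. A x = B x}"
      by (intro closed_Collect_eq linear_continuous_on AB[THEN bounded_clinearD(1)])
  qed (simp add: eq)
  then show "A x = B x" by simp
qed

lemma cinner_eq_on_total_family:
  fixes p :: "'i \<Rightarrow> 'a::complex_inner" and A :: "'a \<Rightarrow> 'b::complex_inner"
  assumes dense: "closure (cspan (range p)) = UNIV" and A: "bounded_clinear A"
    and eq: "\<And>i. cinner u (p i) = cinner v (A (p i))"
  shows "cinner u z = cinner v (A z)"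
proof -
  have "z \<in> {z. cinner u z = cinner v (A z)}"
  proof (rule closed_csubspace_total_family[OF dense])
    show "csubspace {z. cinner u z = cinner v (A z)}"
      by (auto simp: complex_vector.subspace_def bounded_clinearD[OF A] cinner_add_right
          cinner_scaleC_right)
    show "closed {z. cinner u z = cinner v (A z)}"
      by (intro closed_Collect_eq linear_continuous_on bounded_linear_cinner_right
          bounded_linear_compose[OF bounded_linear_cinner_right bounded_clinearD(1)[OF A]])
  qed (simp add: eq)
  then show ?thesis by simp
qed


section \<open>Extending a map from a total family\<close>

text \<open>The pairs \<open>(\<Sum> c\<^sub>i p\<^sub>i, \<Sum> c\<^sub>i q\<^sub>i)\<close>. As a set of pairs this does not presuppose that the
  assignment \<open>p\<^sub>i \<mapsto> q\<^sub>i\<close> is compatible with the linear relations between the \<open>p\<^sub>i\<close>.\<close>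

inductive_set span_graph ::
    "('i \<Rightarrow> 'a::complex_inner) \<Rightarrow> ('i \<Rightarrow> 'b::complex_inner) \<Rightarrow> ('a \<times> 'b) set"
  for p q where
  zero: "(0, 0) \<in> span_graph p q"
| step: "(x, y) \<in> span_graph p q \<Longrightarrow> (x + c *\<^sub>C p i, y + c *\<^sub>C q i) \<in> span_graph p q"

lemma span_graph_add:
  assumes "(x, y) \<in> span_graph p q" and "(x', y') \<in> span_graph p q"
  shows "(x + x', y + y') \<in> span_graph p q"
  using assms(2)
proof induction
  case zero
  then show ?case using assms(1) by simp
next
  case (step x' y' c i)
  then show ?case
    using span_graph.step[OF step.IH, where c = c and i = i] by (simp add: add.assoc)
qed

lemma span_graph_scale:
  assumes "(x, y) \<in> span_graph p q"
  shows "(c *\<^sub>C x, c *\<^sub>C y) \<in> span_graph p q"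
  using assms
proof induction
  case zero
  then show ?case using span_graph.zero by simp
next
  case (step x y d i)
  then show ?case
    using span_graph.step[OF step.IH, where c = "c * d" and i = i]
    by (simp add: complex_vector.scale_right_distrib)
qed

lemma span_graph_total:
  assumes "x \<in> cspan (range p)"
  shows "\<exists>y. (x, y) \<in> span_graph p q"
proof -
  have "csubspace {x. \<exists>y. (x, y) \<in> span_graph p q}"
    unfolding complex_vector.subspace_def
    using span_graph.zero span_graph_add span_graph_scale by blast
  moreover have "range p \<subseteq> {x. \<exists>y. (x, y) \<in> span_graph p q}"
  proof clarify
    fix i show "\<exists>y. (p i, y) \<in> span_graph p q"
      using span_graph.step[OF span_graph.zero, where c = 1 and i = i] by auto
  qed
  ultimately show ?thesis
    using complex_vector.span_minimal assms by blast
qed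

text \<open>The bound makes the closure of the graph single-valued and, the target being complete,
  defined everywhere, so that it is the graph of the required operator.\<close>

lemma bounded_clinear_extension:
  fixes p :: "'i \<Rightarrow> 'a::complex_inner" and q :: "'i \<Rightarrow> 'b::chilbert_space"
  assumes dense: "closure (cspan (range p)) = UNIV"
    and bound: "\<And>x y. (x, y) \<in> span_graph p q \<Longrightarrow> norm y \<le> M * norm x"
  obtains A where "bounded_clinear A" and "\<And>i. A (p i) = q i" and "\<And>x. norm (A x) \<le> M * norm x"
proof -
  define R where "R x y \<longleftrightarrow>
    (\<exists>X Y. (\<forall>n. (X n, Y n) \<in> span_graph p q) \<and> X \<longlonglongrightarrow> x \<and> Y \<longlonglongrightarrow> y)" for x y
  have R_add: "R (x + x') (y + y')" if "R x y" "R x' y'" for x x' y y'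
  proof -
    from that obtain X Y X' Y' where "\<forall>n. (X n, Y n) \<in> span_graph p q" "X \<longlonglongrightarrow> x" "Y \<longlonglongrightarrow> y"
      "\<forall>n. (X' n, Y' n) \<in> span_graph p q" "X' \<longlonglongrightarrow> x'" "Y' \<longlonglongrightarrow> y'"
      unfolding R_def by blast
    then show ?thesis
      unfolding R_def
      by (intro exI[of _ "\<lambda>n. X n + X' n"] exI[of _ "\<lambda>n. Y n + Y' n"])
        (auto intro: tendsto_add span_graph_add)
  qed
  have R_scale: "R (c *\<^sub>C x) (c *\<^sub>C y)" if "R x y" for c x y
  proof -
    from that obtain X Y where "\<forall>n. (X n, Y n) \<in> span_graph p q" "X \<longlonglongrightarrow> x" "Y \<longlonglongrightarrow> y"
      unfolding R_def by blast
    then show ?thesis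
      unfolding R_def
      by (intro exI[of _ "\<lambda>n. c *\<^sub>C X n"] exI[of _ "\<lambda>n. c *\<^sub>C Y n"])
        (auto intro: span_graph_scale bounded_linear.tendsto[OF
            bounded_clinearD(1)[OF bounded_clinear_scaleC]])
  qed
  have R_bound: "norm y \<le> M * norm x" if "R x y" for x y
  proof -
    from that obtain X Y where XY: "\<forall>n. (X n, Y n) \<in> span_graph p q" "X \<longlonglongrightarrow> x" "Y \<longlonglongrightarrow> y"
      unfolding R_def by blast
    have "(\<lambda>n. norm (Y n)) \<longlonglongrightarrow> norm y" "(\<lambda>n. M * norm (X n)) \<longlonglongrightarrow> M * norm x"
      using XY by (auto intro: tendsto_intros)
    then show ?thesis
      by (rule LIMSEQ_le) (use XY bound in blast)
  qed
  have R_unique: "y = y'" if "R x y" "R x y'" for x y y'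
    using R_bound[OF R_add[OF that(1) R_scale[OF that(2), of "-1"]]] by simp
  have R_total: "\<exists>y. R x y" for x
  proof -
    have "x \<in> closure (cspan (range p))" using dense by simp
    then obtain X where X: "\<And>n. X n \<in> cspan (range p)" "X \<longlonglongrightarrow> x"
      by (auto simp: closure_sequential)
    then have "\<forall>n. \<exists>y. (X n, y) \<in> span_graph p q"
      using span_graph_total by blast
    then obtain Y where Y: "\<And>n. (X n, Y n) \<in> span_graph p q"
      by metis
    have le: "dist (Y m) (Y n) \<le> \<bar>M\<bar> * dist (X m) (X n)" for m n
    proof -
      have "(X m - X n, Y m - Y n) \<in> span_graph p q"
        using span_graph_add[OF Y span_graph_scale[OF Y, of "-1"]] by simp
      then have "norm (Y m - Y n) \<le> M * norm (X m - X n)"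
        by (rule bound)
      also have "\<dots> \<le> \<bar>M\<bar> * norm (X m - X n)"
        by (intro mult_right_mono) auto
      finally show ?thesis by (simp add: dist_norm)
    qed
    have "Cauchy Y"
    proof (rule metric_CauchyI)
      fix e :: real assume e: "e > 0"
      have "Cauchy X" using X(2) LIMSEQ_imp_Cauchy by blast
      moreover have "e / (\<bar>M\<bar> + 1) > 0" using e by simp
      ultimately obtain N where N: "\<forall>m\<ge>N. \<forall>n\<ge>N. dist (X m) (X n) < e / (\<bar>M\<bar> + 1)"
        using metric_CauchyD by blast
      have "dist (Y m) (Y n) < e" if "m \<ge> N" "n \<ge> N" for m n
      proof -
        have "(\<bar>M\<bar> + 1) * dist (X m) (X n) < e"
          using N that by (simp add: pos_less_divide_eq mult.commute)
        then show ?thesis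
          using le[of m n] by (simp add: algebra_simps) (smt (verit) zero_le_dist)
      qed
      then show "\<exists>N. \<forall>m\<ge>N. \<forall>n\<ge>N. dist (Y m) (Y n) < e" by blast
    qed
    then obtain y where "Y \<longlonglongrightarrow> y"
      using Cauchy_convergent convergent_def by blast
    then show ?thesis
      using X(2) Y unfolding R_def by blast
  qed
  define A where "A x = (THE y. R x y)" for x
  have RA: "R x (A x)" for x
    unfolding A_def by (rule theI') (use R_total R_unique in blast)
  have A: "A x = y" if "R x y" for x y
    by (rule R_unique[OF RA that])
  show thesis
  proof
    show "bounded_clinear A"
      by (rule bounded_clinearI[where M = M])
        (auto intro: A R_add R_scale RA R_bound[OF RA])
    show "A (p i) = q i" for i
    proof (rule A)
      have "(p i, q i) \<in> span_graph p q"
        using span_graph.step[OF span_graph.zero, where c = 1 and i = i] by simp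
      then show "R (p i) (q i)"
        unfolding R_def by (intro exI[of _ "\<lambda>_. p i"] exI[of _ "\<lambda>_. q i"]) auto
    qed
    show "norm (A x) \<le> M * norm x" for x
      by (rule R_bound[OF RA])
  qed
qed

text \<open>A map multiplying all inner products between the vectors of a total family by a constant
  is well defined on linear combinations, since it scales their norms.\<close>

lemma span_graph_scaled_isometry:
  assumes pq: "\<And>i j. cinner (q i) (q j) = of_real (k\<^sup>2) * cinner (p i) (p j)" and k: "k \<ge> 0"
    and xy: "(x, y) \<in> span_graph p q"
  shows "norm y = k * norm x"
proof -
  have left: "cinner y' (q j) = of_real (k\<^sup>2) * cinner x' (p j)" if "(x', y') \<in> span_graph p q"
    for x' y' j
    using that by induction (auto simp: cinner_add_left cinner_scaleC_left pq algebra_simps)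
  have "cinner y' y = of_real (k\<^sup>2) * cinner x' x" if "(x', y') \<in> span_graph p q" for x' y'
    using xy
    by induction (auto simp: cinner_add_right cinner_scaleC_right left[OF that] algebra_simps)
  from this[OF xy] have "(norm y)\<^sup>2 = (k * norm x)\<^sup>2"
    unfolding cinner_norm by (simp add: power_mult_distrib flip: of_real_mult of_real_power)
  then show ?thesis
    using k by (metis mult_nonneg_nonneg norm_ge_zero power2_eq_imp_eq)
qed


section \<open>Creation operators and their adjoints\<close>

lemma full_fock_space_total: "full_fock_space tens \<Longrightarrow> closure (cspan (range tens)) = UNIV"
  by (simp add: full_fock_space_def)

lemma cinner_tens:
  assumes "full_fock_space tens"
  shows "cinner (tens []) (tens []) = 1"
    and "cinner (tens (x # xs)) (tens []) = 0"
    and "cinner (tens []) (tens (y # ys)) = 0"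
    and "cinner (tens (x # xs)) (tens (y # ys)) = cinner x y * cinner (tens xs) (tens ys)"
proof -
  have eq: "length xs = length ys \<Longrightarrow>
        cinner (tens xs) (tens ys) = (\<Prod>i<length xs. cinner (xs ! i) (ys ! i))"
    and ne: "length xs \<noteq> length ys \<Longrightarrow> cinner (tens xs) (tens ys) = 0" for xs ys
    using assms by (auto simp: full_fock_space_def)
  show "cinner (tens []) (tens []) = 1" "cinner (tens (x # xs)) (tens []) = 0"
    "cinner (tens []) (tens (y # ys)) = 0"
    by (simp_all add: eq ne)
  show "cinner (tens (x # xs)) (tens (y # ys)) = cinner x y * cinner (tens xs) (tens ys)"
    by (cases "length xs = length ys")
      (simp_all add: eq ne prod.lessThan_Suc_shift del: prod.lessThan_Suc)
qed

lemma left_creation: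
  fixes tens :: "'h::chilbert_space list \<Rightarrow> 'f::chilbert_space"
  assumes F: "full_fock_space tens"
  shows "bounded_clinear (left_creation tens \<xi>)"
    and "left_creation tens \<xi> (tens xs) = tens (\<xi> # xs)"
    and "norm (left_creation tens \<xi> x) \<le> norm \<xi> * norm x"
proof -
  note dense = full_fock_space_total[OF F]
  have iso: "cinner (tens (\<xi> # xs)) (tens (\<xi> # ys)) =
      of_real ((norm \<xi>)\<^sup>2) * cinner (tens xs) (tens ys)" for xs ys
    by (simp add: cinner_tens[OF F] cinner_norm)
  obtain A where A: "bounded_clinear A" "\<And>xs. A (tens xs) = tens (\<xi> # xs)"
      "\<And>x. norm (A x) \<le> norm \<xi> * norm x"
    using bounded_clinear_extension[OF dense, of "\<lambda>xs. tens (\<xi> # xs)" "norm \<xi>"]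
      span_graph_scaled_isometry[where q = "\<lambda>xs. tens (\<xi> # xs)", OF iso norm_ge_zero]
    by (metis order_refl)
  have "left_creation tens \<xi> = A"
    unfolding left_creation_def
    by (rule the_equality) (use A in \<open>auto intro: bounded_clinear_eqI[OF dense]\<close>)
  with A show "bounded_clinear (left_creation tens \<xi>)"
    "left_creation tens \<xi> (tens xs) = tens (\<xi> # xs)"
    "norm (left_creation tens \<xi> x) \<le> norm \<xi> * norm x"
    by auto
qed

lemma cadjoint_eqI:
  assumes B: "bounded_clinear B" and adj: "\<And>x y. cinner (A x) y = cinner x (B y)"
  shows "cadjoint A = B"
  unfolding cadjoint_def
proof (rule the_equality)
  fix C assume C: "bounded_clinear C \<and> (\<forall>x y. cinner (A x) y = cinner x (C y))"
  have "C y = B y" for y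
  proof -
    have "cinner (C y - B y) (C y) = cinner (C y - B y) (B y)"
      using C adj by metis
    then have "cinner (C y - B y) (C y - B y) = 0"
      using cinner_add_right[of "C y - B y" "C y - B y" "B y"] by simp
    then show ?thesis by (simp add: cinner_norm)
  qed
  then show "C = B" by blast
qed (use assms in blast)

fun annihilation_tens :: "('h::chilbert_space list \<Rightarrow> 'f::chilbert_space) \<Rightarrow> 'h \<Rightarrow> 'h list \<Rightarrow> 'f" where
  "annihilation_tens tens \<xi> [] = 0"
| "annihilation_tens tens \<xi> (x # xs) = cinner x \<xi> *\<^sub>C tens xs"

text \<open>The prescribed values are formally adjoint to the creation operator on elementary tensors.
  By density this holds against every vector, and testing \<open>y\<close> against itself bounds it:
  \<open>\<Parallel>y\<Parallel>\<^sup>2 = \<langle>x, l(\<xi>) y\<rangle> \<le> \<Parallel>x\<Parallel> \<Parallel>\<xi>\<Parallel> \<Parallel>y\<Parallel>\<close>.\<close>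

lemma cadjoint_left_creation:
  fixes tens :: "'h::chilbert_space list \<Rightarrow> 'f::chilbert_space"
  assumes F: "full_fock_space tens"
  shows "bounded_clinear (cadjoint (left_creation tens \<xi>))"
    and "cadjoint (left_creation tens \<xi>) (tens []) = 0"
    and "cadjoint (left_creation tens \<xi>) (tens (x # xs)) = cinner x \<xi> *\<^sub>C tens xs"
    and "norm (cadjoint (left_creation tens \<xi>) u) \<le> norm \<xi> * norm u"
    and "cinner (left_creation tens \<xi> v) w = cinner v (cadjoint (left_creation tens \<xi>) w)"
proof -
  note dense = full_fock_space_total[OF F]
  let ?l = "left_creation tens \<xi>" and ?q = "annihilation_tens tens \<xi>"
  note l = left_creation[OF F, of \<xi>]
  have tens: "cinner (?q xs) z = cinner (tens xs) (?l z)" for xs z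
  proof (rule cinner_eq_on_total_family[OF dense l(1)])
    show "cinner (?q xs) (tens ys) = cinner (tens xs) (?l (tens ys))" for ys
      by (cases xs) (simp_all add: l cinner_tens[OF F] cinner_scaleC_left)
  qed
  have graph: "cinner y z = cinner x (?l z)" if "(x, y) \<in> span_graph tens ?q" for x y z
    using that by induction (auto simp: cinner_add_left cinner_scaleC_left tens)
  have bound: "norm y \<le> norm \<xi> * norm x" if "(x, y) \<in> span_graph tens ?q" for x y
  proof (cases "y = 0")
    case False
    have "(norm y)\<^sup>2 = cmod (cinner y y)"
      by (simp add: cinner_norm flip: of_real_power)
    also have "\<dots> \<le> norm x * norm (?l y)"
      unfolding graph[OF that] by (rule cinner_Cauchy_Schwarz)
    also have "\<dots> \<le> norm x * (norm \<xi> * norm y)"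
      by (intro mult_left_mono l(3)) auto
    finally show ?thesis
      using False by (simp add: power2_eq_square mult_ac)
  qed auto
  obtain A where A: "bounded_clinear A" "\<And>xs. A (tens xs) = ?q xs"
      "\<And>x. norm (A x) \<le> norm \<xi> * norm x"
    using bounded_clinear_extension[OF dense bound] by metis
  have adj: "cinner (?l v) w = cinner v (A w)" for v w
  proof (rule cinner_eq_on_total_family[OF dense A(1)])
    show "cinner (?l v) (tens xs) = cinner v (A (tens xs))" for xs
      using tens[of xs v] unfolding A(2) by (metis cinner_commute)
  qed
  have "cadjoint ?l = A"
    by (rule cadjoint_eqI[OF A(1) adj])
  with A adj show "bounded_clinear (cadjoint ?l)" "cadjoint ?l (tens []) = 0"
    "cadjoint ?l (tens (x # xs)) = cinner x \<xi> *\<^sub>C tens xs"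
    "norm (cadjoint ?l u) \<le> norm \<xi> * norm u" "cinner (?l v) w = cinner v (cadjoint ?l w)"
    by auto
qed

text \<open>Reading all elementary tensors backwards gives another full Fock space structure, for which
  right creation is left creation.\<close>

lemma full_fock_space_rev:
  assumes F: "full_fock_space tens"
  shows "full_fock_space (tens \<circ> rev)"
proof -
  have prod: "(\<Prod>i<length xs. cinner (rev xs ! i) (rev ys ! i)) =
      (\<Prod>i<length xs. cinner (xs ! i) (ys ! i))"
    if "length xs = length ys" for xs ys :: "'a list"
    by (rule prod.reindex_bij_witness[where i = "\<lambda>i. length xs - Suc i" and
          j = "\<lambda>i. length xs - Suc i"])
      (use that in \<open>auto simp: rev_nth\<close>)
  have "range (tens \<circ> rev) = range tens"
    by (metis fun.set_map surj_def rev_rev_ident)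
  then show ?thesis
    using F prod unfolding full_fock_space_def by simp
qed

lemma right_creation_eq_left_creation_rev: "right_creation tens = left_creation (tens \<circ> rev)"
proof
  fix \<xi>
  have "(\<forall>xs. A (tens xs) = tens (xs @ [\<xi>])) \<longleftrightarrow> (\<forall>xs. A (tens (rev xs)) = tens (rev xs @ [\<xi>]))" for A
    by (metis rev_rev_ident)
  then show "right_creation tens \<xi> = left_creation (tens \<circ> rev) \<xi>"
    by (simp add: right_creation_def left_creation_def)
qed

definition field_operator :: "('h::chilbert_space list \<Rightarrow> 'f::chilbert_space) \<Rightarrow> 'h \<Rightarrow> 'f \<Rightarrow> 'f" where
  "field_operator tens \<xi> x = left_creation tens \<xi> x + cadjoint (left_creation tens \<xi>) x"

lemma field_operator:
  fixes tens :: "'h::chilbert_space list \<Rightarrow> 'f::chilbert_space"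
  assumes F: "full_fock_space tens"
  shows "bounded_clinear (field_operator tens \<xi>)"
    and "field_operator tens \<xi> (tens []) = tens [\<xi>]"
    and "field_operator tens \<xi> (tens (x # xs)) = tens (\<xi> # x # xs) + cinner x \<xi> *\<^sub>C tens xs"
    and "norm (field_operator tens \<xi> u) \<le> 2 * norm \<xi> * norm u"
    and "cinner (field_operator tens \<xi> v) w = cinner v (field_operator tens \<xi> w)"
proof -
  note l = left_creation[OF F, of \<xi>] and ls = cadjoint_left_creation[OF F, of \<xi>]
  show "bounded_clinear (field_operator tens \<xi>)"
    unfolding field_operator_def[abs_def] by (intro bounded_clinear_add l ls)
  show "field_operator tens \<xi> (tens []) = tens [\<xi>]"
    "field_operator tens \<xi> (tens (x # xs)) = tens (\<xi> # x # xs) + cinner x \<xi> *\<^sub>C tens xs"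
    by (simp_all add: field_operator_def l ls)
  show "norm (field_operator tens \<xi> u) \<le> 2 * norm \<xi> * norm u"
    using norm_triangle_ineq[of "left_creation tens \<xi> u" "cadjoint (left_creation tens \<xi>) u"]
      l(3)[of u] ls(4)[of u] by (simp add: field_operator_def)
  have "cinner (cadjoint (left_creation tens \<xi>) v) w = cinner v (left_creation tens \<xi> w)"
    using ls(5)[of w v] by (metis cinner_commute)
  then show "cinner (field_operator tens \<xi> v) w = cinner v (field_operator tens \<xi> w)"
    by (simp add: field_operator_def cinner_add_left cinner_add_right ls(5))
qed

lemma cinner_field_operator_self:
  assumes F: "full_fock_space tens"
  shows "Im (cinner (field_operator tens \<xi> x) x) = 0"
    and "\<bar>Re (cinner (field_operator tens \<xi> x) x)\<bar> \<le> 2 * norm \<xi> * (norm x)\<^sup>2"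
proof -
  have "cinner (field_operator tens \<xi> x) x = cnj (cinner (field_operator tens \<xi> x) x)"
    by (metis cinner_commute field_operator(5)[OF F])
  then show "Im (cinner (field_operator tens \<xi> x) x) = 0"
    by (simp add: complex_eq_iff)
  have "\<bar>Re (cinner (field_operator tens \<xi> x) x)\<bar> \<le> norm (field_operator tens \<xi> x) * norm x"
    using abs_Re_le_cmod cinner_Cauchy_Schwarz order_trans by blast
  also have "\<dots> \<le> 2 * norm \<xi> * norm x * norm x"
    by (intro mult_right_mono field_operator(4)[OF F]) auto
  finally show "\<bar>Re (cinner (field_operator tens \<xi> x) x)\<bar> \<le> 2 * norm \<xi> * (norm x)\<^sup>2"
    by (simp add: power2_eq_square)
qed


section \<open>The spectrum lies in the numerical rectangle\<close>

text \<open>A coercive operator on a closed subspace is invertible there: for small \<open>t > 0\<close> the map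
  \<open>x \<mapsto> x - t (S x - y)\<close> is a contraction, because
  \<open>\<Parallel>x - t S x\<Parallel>\<^sup>2 \<le> (1 - 2 t d + t\<^sup>2 M\<^sup>2) \<Parallel>x\<Parallel>\<^sup>2\<close>, and its fixed point solves \<open>S x = y\<close>.\<close>

lemma coercive_imp_bij_betw:
  fixes S :: "'a::chilbert_space \<Rightarrow> 'a"
  assumes K: "csubspace K" "closed K" and S: "bounded_clinear S" and SK: "\<And>x. x \<in> K \<Longrightarrow> S x \<in> K"
    and d: "d > 0" and coercive: "\<And>x. x \<in> K \<Longrightarrow> d * (norm x)\<^sup>2 \<le> Re (cinner (S x) x)"
  shows "bij_betw S K K" and "\<And>x. x \<in> K \<Longrightarrow> d * norm x \<le> norm (S x)"
proof -
  have Kadd: "\<And>x y. x \<in> K \<Longrightarrow> y \<in> K \<Longrightarrow> x + y \<in> K" and Kdiff: "\<And>x y. x \<in> K \<Longrightarrow> y \<in> K \<Longrightarrow> x - y \<in> K"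
    and Kscale: "\<And>c x. x \<in> K \<Longrightarrow> c *\<^sub>C x \<in> K" and K0: "0 \<in> K"
    using K(1) complex_vector.subspace_add complex_vector.subspace_diff
      complex_vector.subspace_scale complex_vector.subspace_0 by blast+
  have KscaleR: "r *\<^sub>R x \<in> K" if "x \<in> K" for r x
    using Kscale[OF that, of "of_real r"] by (simp add: scaleC_of_real)
  show lower: "d * norm x \<le> norm (S x)" if "x \<in> K" for x
  proof (cases "x = 0")
    case False
    have "d * (norm x)\<^sup>2 \<le> cmod (cinner (S x) x)"
      using coercive[OF that] complex_Re_le_cmod[of "cinner (S x) x"] by linarith
    also have "\<dots> \<le> norm (S x) * norm x" by (rule cinner_Cauchy_Schwarz)
    finally show ?thesis using False by (simp add: power2_eq_square)
  qed auto
  obtain M where M: "M > 0" "\<And>x. norm (S x) \<le> M * norm x"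
    using bounded_clinear_bound[OF S] by metis
  define t where "t = d / M\<^sup>2"
  define q where "q = 1 - d\<^sup>2 / M\<^sup>2"
  have t: "t > 0" using d M by (simp add: t_def)
  have q: "1 - 2 * t * d + t\<^sup>2 * M\<^sup>2 = q"
    using M(1) by (simp add: t_def q_def field_simps power2_eq_square)
  have contract: "(norm (x - t *\<^sub>R S x))\<^sup>2 \<le> q * (norm x)\<^sup>2" if "x \<in> K" for x
  proof -
    have "(norm (x - t *\<^sub>R S x))\<^sup>2 = (norm (x + (- t) *\<^sub>R S x))\<^sup>2" by simp
    also have "\<dots> = (norm x)\<^sup>2 + t\<^sup>2 * (norm (S x))\<^sup>2 + 2 * Re (cinner x ((- t) *\<^sub>R S x))"
      by (simp only: norm_add_square norm_scaleR power_mult_distrib power2_abs) simp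
    also have "Re (cinner x ((- t) *\<^sub>R S x)) = - t * Re (cinner (S x) x)"
      by (subst cinner_commute)
        (simp del: scaleR_minus_left add: scaleC_of_real[symmetric] cinner_scaleC_left cinner_minus_left)
    also have "(norm x)\<^sup>2 + t\<^sup>2 * (norm (S x))\<^sup>2 + 2 * (- t * Re (cinner (S x) x)) \<le>
        (norm x)\<^sup>2 + t\<^sup>2 * (M * norm x)\<^sup>2 + 2 * (- t * (d * (norm x)\<^sup>2))"
      using t by (intro add_mono mult_left_mono power_mono M(2) mult_left_mono_neg coercive that) auto
    also have "\<dots> = q * (norm x)\<^sup>2"
      by (simp add: q[symmetric] algebra_simps power_mult_distrib)
    finally show ?thesis .
  qed
  \<comment> \<open>If \<open>K = 0\<close>, then \<open>d\<close> may exceed \<open>M\<close> and \<open>q\<close> may be negative.\<close>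
  have q0: "max q 0 \<ge> 0" "max q 0 < 1"
    using d M(1) by (auto simp: q_def)
  have surj: "\<exists>x\<in>K. S x = y" if y: "y \<in> K" for y
  proof -
    define f where "f x = x - t *\<^sub>R (S x - y)" for x
    have "\<exists>!x. x \<in> K \<and> f x = x"
    proof (rule Banach_fix)
      show "complete K" using K(2) by (simp add: complete_eq_closed)
      show "K \<noteq> {}" using K0 by blast
      show "0 \<le> sqrt (max q 0)" "sqrt (max q 0) < 1" using q0 by auto
      show "f ` K \<subseteq> K"
        using y SK Kdiff KscaleR by (auto simp: f_def)
      show "dist (f x) (f x') \<le> sqrt (max q 0) * dist x x'" if "x \<in> K" "x' \<in> K" for x x'
      proof -
        have "f x - f x' = (x - x') - t *\<^sub>R S (x - x')"
          by (simp add: f_def bounded_clinearD(4)[OF S] algebra_simps)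
        then have "(dist (f x) (f x'))\<^sup>2 \<le> q * (dist x x')\<^sup>2"
          using contract[OF Kdiff[OF that]] by (simp add: dist_norm)
        also have "\<dots> \<le> max q 0 * (dist x x')\<^sup>2"
          by (intro mult_right_mono) auto
        finally have "dist (f x) (f x') \<le> sqrt (max q 0 * (dist x x')\<^sup>2)"
          by (rule real_le_rsqrt)
        then show ?thesis by (simp add: real_sqrt_mult)
      qed
    qed
    then obtain x where "x \<in> K" "f x = x" by blast
    then show ?thesis using t by (auto simp: f_def)
  qed
  have "inj_on S K"
  proof (rule inj_onI)
    fix x y assume "x \<in> K" "y \<in> K" "S x = S y"
    then have "d * norm (x - y) \<le> 0"
      using lower[OF Kdiff, of x y] by (simp add: bounded_clinearD(4)[OF S])
    then show "x = y"
      using d by (simp add: mult_le_0_iff)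
  qed
  then show "bij_betw S K K"
    using SK surj by (force simp: bij_betw_def)
qed

lemma restrict_mem_carrier_bounded_ops:
  assumes "bounded_clinear S" and "\<And>x. x \<in> K \<Longrightarrow> S x \<in> K" and "csubspace K"
  shows "restrict S K \<in> carrier (bounded_ops K)"
  using assms complex_vector.subspace_add[OF assms(3)] complex_vector.subspace_scale[OF assms(3)]
    bounded_clinear_bound[OF assms(1)]
  by (auto simp: bounded_ops_def bounded_clinearD[OF assms(1)]) metis

lemma bij_betw_imp_Units_bounded_ops:
  assumes K: "csubspace K" and S: "bounded_clinear S" and bij: "bij_betw S K K"
    and d: "d > 0" and lower: "\<And>x. x \<in> K \<Longrightarrow> d * norm x \<le> norm (S x)"
  shows "restrict S K \<in> Units (bounded_ops K)"
proof -
  define R where "R = inv_into K S"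
  have SK: "S x \<in> K" and RS: "R (S x) = x" if "x \<in> K" for x
    using that bij by (auto simp: R_def bij_betw_def)
  have RK: "R y \<in> K" and SR: "S (R y) = y" if "y \<in> K" for y
    using that bij by (auto simp: R_def bij_betw_def f_inv_into_f inv_into_into)
  note Kadd = complex_vector.subspace_add[OF K] and Kscale = complex_vector.subspace_scale[OF K]
  have "R (x + y) = R x + R y" if "x \<in> K" "y \<in> K" for x y
    using RS[OF Kadd[OF RK[OF that(1)] RK[OF that(2)]]] that by (simp add: bounded_clinearD[OF S] SR)
  moreover have "R (c *\<^sub>C x) = c *\<^sub>C R x" if "x \<in> K" for x c
    using RS[OF Kscale[OF RK[OF that]]] that by (simp add: bounded_clinearD[OF S] SR)
  moreover have "norm (R x) \<le> inverse d * norm x" if "x \<in> K" for x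
    using lower[OF RK[OF that]] d that by (simp add: SR field_simps)
  ultimately have "restrict R K \<in> carrier (bounded_ops K)"
    using RK Kadd Kscale by (auto simp: bounded_ops_def intro!: exI[of _ "inverse d"])
  moreover have "restrict S K \<in> carrier (bounded_ops K)"
    by (rule restrict_mem_carrier_bounded_ops[OF S SK K])
  moreover have "restrict R K \<otimes>\<^bsub>bounded_ops K\<^esub> restrict S K = \<one>\<^bsub>bounded_ops K\<^esub>"
    and "restrict S K \<otimes>\<^bsub>bounded_ops K\<^esub> restrict R K = \<one>\<^bsub>bounded_ops K\<^esub>"
    by (auto simp: bounded_ops_def fun_eq_iff SK RK RS SR)
  ultimately show ?thesis
    unfolding Units_def by blast
qed

text \<open>If \<open>z\<close> is beyond one of the sides of the rectangle, then the numerical range of \<open>T - z\<close> lies in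
  a half-plane at a positive distance from \<open>0\<close>. Multiplication by \<open>1\<close>, \<open>-1\<close>, \<open>i\<close> or \<open>-i\<close> turns this
  into a right half-plane, that is, makes the operator coercive.\<close>

lemma op_spectrum_subset_numerical_rectangle:
  fixes T :: "'a::chilbert_space \<Rightarrow> 'a"
  assumes K: "csubspace K" "closed K" and T: "bounded_clinear T" and TK: "\<And>x. x \<in> K \<Longrightarrow> T x \<in> K"
    and Re: "\<And>x. x \<in> K \<Longrightarrow> \<bar>Re (cinner (T x) x)\<bar> \<le> a * (norm x)\<^sup>2"
    and Im: "\<And>x. x \<in> K \<Longrightarrow> \<bar>Im (cinner (T x) x)\<bar> \<le> b * (norm x)\<^sup>2"
  shows "op_spectrum K T \<subseteq> {z. \<bar>Re z\<bar> \<le> a \<and> \<bar>Im z\<bar> \<le> b}"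
proof clarify
  fix z assume z: "z \<in> op_spectrum K T"
  define S where "S x = T x - z *\<^sub>C x" for x
  have S_add: "S = (\<lambda>x. T x + (- z) *\<^sub>C x)"
    by (simp add: S_def fun_eq_iff)
  have S: "bounded_clinear S"
    unfolding S_add by (intro bounded_clinear_add T bounded_clinear_scaleC)
  have SK: "S x \<in> K" if "x \<in> K" for x
    unfolding S_def using that TK complex_vector.subspace_diff[OF K(1)]
      complex_vector.subspace_scale[OF K(1)] by blast
  have no_coercive: False
    if u: "cmod u = 1" and d: "d > 0"
      and coercive: "\<And>x. x \<in> K \<Longrightarrow> d * (norm x)\<^sup>2 \<le> Re (u * cinner (S x) x)" for u d
  proof -
    have uS: "bounded_clinear (\<lambda>x. u *\<^sub>C S x)"
      by (rule bounded_clinear_scale[OF S])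
    have bij: "bij_betw (\<lambda>x. u *\<^sub>C S x) K K"
      and lower: "\<And>x. x \<in> K \<Longrightarrow> d * norm x \<le> norm (u *\<^sub>C S x)"
      using coercive_imp_bij_betw[OF K uS _ d] coercive SK
        complex_vector.subspace_scale[OF K(1)] by (auto simp: cinner_scaleC_left)
    have "bij_betw ((*\<^sub>C) (cnj u)) K K"
    proof (rule bij_betwI[where g = "(*\<^sub>C) u"])
      have "cnj u * u = 1" using u by (simp add: complex_norm_square[symmetric] mult.commute)
      then show "cnj u *\<^sub>C u *\<^sub>C x = x" "u *\<^sub>C cnj u *\<^sub>C x = x" for x :: 'a
        by (simp_all add: mult.commute)
    qed (use complex_vector.subspace_scale[OF K(1)] in auto)
    from bij_betw_trans[OF bij this] have "bij_betw S K K"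
      using u by (simp add: o_def complex_norm_square[symmetric] mult.commute)
    then have "restrict S K \<in> Units (bounded_ops K)"
      using bij_betw_imp_Units_bounded_ops[OF K(1) S _ d] lower u by (simp add: norm_scaleC)
    then show False
      using z by (simp add: op_spectrum_def S_def[abs_def])
  qed
  have inner: "cinner (S x) x = cinner (T x) x - z * of_real ((norm x)\<^sup>2)" for x
    by (simp add: S_def cinner_diff_left cinner_scaleC_left cinner_norm)
  have bounds: "Re (cinner (T x) x) \<le> a * (norm x)\<^sup>2" "- (a * (norm x)\<^sup>2) \<le> Re (cinner (T x) x)"
    "Im (cinner (T x) x) \<le> b * (norm x)\<^sup>2" "- (b * (norm x)\<^sup>2) \<le> Im (cinner (T x) x)"
    if "x \<in> K" for x
    using Re[OF that] Im[OF that] by (simp_all add: abs_le_iff minus_le_iff)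
  have "\<not> a < Re z"
    using no_coercive[of "-1" "Re z - a"] bounds(1) by (auto simp: inner algebra_simps)
  moreover have "\<not> Re z < - a"
    using no_coercive[of 1 "- Re z - a"] bounds(2) by (auto simp: inner algebra_simps)
  moreover have "\<not> b < Im z"
    using no_coercive[of "\<i>" "Im z - b"] bounds(3) by (auto simp: inner algebra_simps)
  moreover have "\<not> Im z < - b"
    using no_coercive[of "- \<i>" "- Im z - b"] bounds(4) by (auto simp: inner algebra_simps)
  ultimately show "\<bar>Re z\<bar> \<le> a \<and> \<bar>Im z\<bar> \<le> b" by auto
qed


section \<open>Weyl sequences and the essential spectrum\<close>

lemma ring_hom_calkin_map:
  assumes "csubspace K" and "closed K"
  shows "calkin_map K \<in> ring_hom (bounded_ops K) (calkin_algebra K)"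
  using ideal.rcos_ring_hom[OF ideal_compact_ops[OF assms]]
  by (simp add: calkin_map_def[abs_def] calkin_algebra_def)

lemma essential_spectrum_subset_op_spectrum:
  assumes K: "csubspace K" "closed K"
  shows "essential_spectrum K T \<subseteq> op_spectrum K T"
proof -
  note h = ring_hom_calkin_map[OF K]
  have "calkin_map K D \<in> Units (calkin_algebra K)" if D: "D \<in> Units (bounded_ops K)" for D
  proof -
    let ?h = "calkin_map K"
    obtain R where R: "R \<in> carrier (bounded_ops K)" "R \<otimes>\<^bsub>bounded_ops K\<^esub> D = \<one>\<^bsub>bounded_ops K\<^esub>"
        "D \<otimes>\<^bsub>bounded_ops K\<^esub> R = \<one>\<^bsub>bounded_ops K\<^esub>" and D: "D \<in> carrier (bounded_ops K)"
      using D unfolding Units_def by blast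
    have "?h R \<otimes>\<^bsub>calkin_algebra K\<^esub> ?h D = \<one>\<^bsub>calkin_algebra K\<^esub>"
      "?h D \<otimes>\<^bsub>calkin_algebra K\<^esub> ?h R = \<one>\<^bsub>calkin_algebra K\<^esub>"
      using ring_hom_mult[OF h, symmetric] ring_hom_one[OF h] R D by simp_all
    then show ?thesis
      unfolding Units_def using ring_hom_closed[OF h] R(1) D by blast
  qed
  then show ?thesis
    by (auto simp: essential_spectrum_def op_spectrum_def)
qed

lemma calkin_unit_imp_left_parametrix:
  assumes K: "csubspace K" "closed K" and D: "D \<in> carrier (bounded_ops K)"
    and unit: "calkin_map K D \<in> Units (calkin_algebra K)"
  obtains R C where "R \<in> carrier (bounded_ops K)" and "C \<in> compact_ops K"
    and "\<And>x. x \<in> K \<Longrightarrow> R (D x) = C x + x"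
proof -
  interpret I: ideal "compact_ops K" "bounded_ops K"
    by (rule ideal_compact_ops[OF K])
  let ?h = "calkin_map K"
  note h = ring_hom_calkin_map[OF K]
  obtain Y where Y: "Y \<in> carrier (calkin_algebra K)" "Y \<otimes>\<^bsub>calkin_algebra K\<^esub> ?h D = \<one>\<^bsub>calkin_algebra K\<^esub>"
    using unit unfolding Units_def by blast
  have "carrier (calkin_algebra K) = ?h ` carrier (bounded_ops K)"
    by (auto simp: calkin_algebra_def FactRing_def A_RCOSETS_def' calkin_map_def)
  then obtain R where R: "R \<in> carrier (bounded_ops K)" "Y = ?h R"
    using Y(1) by blast
  have "?h (R \<otimes>\<^bsub>bounded_ops K\<^esub> D) = ?h \<one>\<^bsub>bounded_ops K\<^esub>"
    using Y(2) R D by (simp add: ring_hom_mult[OF h] ring_hom_one[OF h])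
  moreover have "R \<otimes>\<^bsub>bounded_ops K\<^esub> D \<in> ?h (R \<otimes>\<^bsub>bounded_ops K\<^esub> D)"
    unfolding calkin_map_def using R(1) D by (intro I.a_rcos_self) auto
  ultimately have "R \<otimes>\<^bsub>bounded_ops K\<^esub> D \<in> ?h \<one>\<^bsub>bounded_ops K\<^esub>" by simp
  then obtain C where C: "C \<in> compact_ops K"
      "R \<otimes>\<^bsub>bounded_ops K\<^esub> D = C \<oplus>\<^bsub>bounded_ops K\<^esub> \<one>\<^bsub>bounded_ops K\<^esub>"
    by (auto simp: calkin_map_def a_r_coset_def')
  have "R (D x) = C x + x" if "x \<in> K" for x
    using fun_cong[OF C(2), of x] that by (simp add: bounded_ops_def)
  with R(1) C(1) show thesis using that by blast
qed

lemma orthonormal_sequence_no_convergent_subsequence: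
  fixes X :: "nat \<Rightarrow> 'a::complex_inner"
  assumes "\<And>n. norm (X n) = 1" and "\<And>m n. m \<noteq> n \<Longrightarrow> cinner (X m) (X n) = 0" and "strict_mono r"
  shows "\<not> convergent (X \<circ> r)"
proof
  assume "convergent (X \<circ> r)"
  then have "Cauchy (X \<circ> r)" by (rule convergent_Cauchy)
  then obtain N where N: "\<forall>m\<ge>N. \<forall>n\<ge>N. dist ((X \<circ> r) m) ((X \<circ> r) n) < 1"
    using metric_CauchyD zero_less_one by blast
  have "r N \<noteq> r (Suc N)"
    using assms(3) by (metis n_not_Suc_n strict_mono_eq)
  then have "(norm (X (r N) + - X (r (Suc N))))\<^sup>2 = 2"
    using assms(1) assms(2)[of "r (Suc N)" "r N"]
    by (simp only: norm_add_square) (subst cinner_commute, simp add: cinner_minus_left)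
  moreover have "(norm (X (r N) + - X (r (Suc N))))\<^sup>2 < 1\<^sup>2"
    using N[rule_format, of N "Suc N"] by (intro power_strict_mono) (auto simp: dist_norm)
  ultimately show False by simp
qed

text \<open>Let \<open>x\<^sub>n\<close> be orthonormal with \<open>(T - z) x\<^sub>n \<longrightarrow> 0\<close>.
  If \<open>T - z\<close> had a left inverse \<open>R\<close> modulo the compact operators, \<open>R (T - z) = C + 1\<close>, then
  \<open>C x\<^sub>n + x\<^sub>n \<longrightarrow> 0\<close>. As \<open>C x\<^sub>n\<close> has a convergent subsequence, so would \<open>x\<^sub>n\<close>.\<close>

lemma orthonormal_Weyl_sequence_imp_essential_spectrum:
  fixes T :: "'a::complex_inner \<Rightarrow> 'a"
  assumes K: "csubspace K" "closed K" and T: "bounded_clinear T" and TK: "\<And>x. x \<in> K \<Longrightarrow> T x \<in> K"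
    and XK: "\<And>n. X n \<in> K" and norm: "\<And>n. norm (X n) = 1"
    and orth: "\<And>m n. m \<noteq> n \<Longrightarrow> cinner (X m) (X n) = 0"
    and lim: "(\<lambda>n. T (X n) - z *\<^sub>C X n) \<longlonglongrightarrow> 0"
  shows "z \<in> essential_spectrum K T"
proof (rule ccontr)
  define D where "D x = T x - z *\<^sub>C x" for x
  have D: "bounded_clinear D"
  proof -
    have "D = (\<lambda>x. T x + (- z) *\<^sub>C x)" by (simp add: D_def fun_eq_iff)
    then show ?thesis by (simp only: bounded_clinear_add T bounded_clinear_scaleC)
  qed
  have DK: "D x \<in> K" if "x \<in> K" for x
    unfolding D_def using that TK complex_vector.subspace_diff[OF K(1)]
      complex_vector.subspace_scale[OF K(1)] by blast
  assume "z \<notin> essential_spectrum K T"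
  then have "calkin_map K (restrict D K) \<in> Units (calkin_algebra K)"
    by (simp add: essential_spectrum_def D_def[abs_def])
  then obtain R C where R: "R \<in> carrier (bounded_ops K)" and C: "C \<in> compact_ops K"
    and RD: "\<And>x. x \<in> K \<Longrightarrow> R (D x) = C x + x"
    using calkin_unit_imp_left_parametrix[OF K
        restrict_mem_carrier_bounded_ops[OF D DK K(1)]] by (metis restrict_apply)
  obtain M where M: "\<And>x. x \<in> K \<Longrightarrow> norm (R x) \<le> M * norm x"
    using R unfolding bounded_ops_def by fastforce
  have sum0: "(\<lambda>n. C (X n) + X n) \<longlonglongrightarrow> 0"
  proof (rule Lim_null_comparison)
    have "norm (C (X n) + X n) \<le> M * norm (D (X n))" for n
      using M[OF DK[OF XK]] RD[OF XK] by metis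
    then show "\<forall>\<^sub>F n in sequentially. norm (C (X n) + X n) \<le> M * norm (D (X n))"
      by simp
    have "(\<lambda>n. D (X n)) \<longlonglongrightarrow> 0" using lim by (simp add: D_def)
    then show "(\<lambda>n. M * norm (D (X n))) \<longlonglongrightarrow> 0"
      using tendsto_mult_right_zero tendsto_norm_zero by blast
  qed
  have "compact (closure (C ` (K \<inter> cball 0 1)))"
    using C by (simp add: compact_ops_def)
  moreover have "\<forall>n. C (X n) \<in> closure (C ` (K \<inter> cball 0 1))"
    using XK norm closure_subset[of "C ` (K \<inter> cball 0 1)"] by auto
  ultimately obtain l r where r: "strict_mono r" and l: "((\<lambda>n. C (X n)) \<circ> r) \<longlonglongrightarrow> l"
    unfolding compact_def by metis
  have "((\<lambda>n. C (X n) + X n) \<circ> r) \<longlonglongrightarrow> 0"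
    by (rule LIMSEQ_subseq_LIMSEQ[OF sum0 r])
  from tendsto_diff[OF this l] have "(X \<circ> r) \<longlonglongrightarrow> - l"
    by (simp add: o_def)
  then have "convergent (X \<circ> r)" by (rule convergentI)
  with orthonormal_sequence_no_convergent_subsequence[of X r, OF norm orth r] show False
    by contradiction
qed


section \<open>Wave packets on a quarter-plane of shifts\<close>

lemma norm_sum_orthonormal:
  fixes g :: "'i \<Rightarrow> 'a::complex_inner"
  assumes orth: "\<And>i j. i \<in> F \<Longrightarrow> j \<in> F \<Longrightarrow> cinner (g i) (g j) = (if i = j then 1 else 0)"
    and unimod: "\<And>i. i \<in> F \<Longrightarrow> cmod (c i) = 1"
  shows "norm (\<Sum>i\<in>F. c i *\<^sub>C g i) = sqrt (card F)"
proof (cases "finite F")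
  case True
  have "cinner (\<Sum>i\<in>F. c i *\<^sub>C g i) (\<Sum>i\<in>F. c i *\<^sub>C g i) =
      (\<Sum>i\<in>F. \<Sum>j\<in>F. if i = j then c i * cnj (c i) else 0)"
    unfolding cinner_sum_left cinner_sum_right
    by (intro sum.cong refl) (auto simp: cinner_scaleC_left cinner_scaleC_right orth)
  also have "\<dots> = (\<Sum>i\<in>F. c i * cnj (c i))"
    using True by (intro sum.cong) auto
  also have "\<dots> = of_nat (card F)"
    using unimod by (simp flip: complex_norm_square)
  finally have "complex_of_real ((norm (\<Sum>i\<in>F. c i *\<^sub>C g i))\<^sup>2) = of_real (card F)"
    by (simp add: cinner_norm)
  then have "(norm (\<Sum>i\<in>F. c i *\<^sub>C g i))\<^sup>2 = card F"
    by (simp only: of_real_eq_iff)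
  then show ?thesis by (metis norm_ge_zero real_sqrt_unique)
qed auto

lemma jacobi_wave_telescope:
  fixes G :: "nat \<Rightarrow> 'a::complex_inner"
  assumes \<omega>: "cmod \<omega> = 1"
  shows "(\<Sum>k<N. \<omega> ^ k *\<^sub>C (G (s + k + 2) + G (s + k) - (\<omega> + cnj \<omega>) *\<^sub>C G (s + k + 1))) =
    (cnj \<omega> * \<omega> ^ N) *\<^sub>C G (s + N + 1) - cnj \<omega> *\<^sub>C G (s + 1) + G s - \<omega> ^ N *\<^sub>C G (s + N)"
proof (induction N)
  case 0
  show ?case by simp
next
  case (Suc N)
  have unit: "cnj \<omega> * \<omega> = 1"
    using \<omega> by (simp add: mult.commute flip: complex_norm_square)
  then have "cnj \<omega> * \<omega> ^ Suc N = \<omega> ^ N"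
    by (simp flip: mult.assoc)
  then show ?case
    unfolding sum.lessThan_Suc Suc.IH
    by (simp only: complex_vector.scale_right_diff_distrib complex_vector.scale_right_distrib
        complex_vector.scale_left_distrib complex_vector.scale_scale) (simp add: mult.commute)
qed

text \<open>On the interior of its support, a plane wave is an eigenvector of the discrete Laplacian, so
  only the four boundary terms remain, however long the packet is.\<close>

lemma jacobi_wave_defect:
  fixes G :: "nat \<Rightarrow> 'a::complex_inner"
  assumes A: "bounded_clinear A"
    and AG: "\<And>k. A (G (Suc k)) = of_real \<alpha> *\<^sub>C (G (k + 2) + G k)"
    and \<omega>: "cmod \<omega> = 1" and \<alpha>: "\<alpha> \<ge> 0" and G: "\<And>k. norm (G k) \<le> M"
    and X_def: "X = (\<Sum>k<N. \<omega> ^ k *\<^sub>C G (s + k + 1))"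
  shows "norm (A X - of_real (2 * \<alpha> * Re \<omega>) *\<^sub>C X) \<le> 4 * \<alpha> * M"
proof -
  have two: "of_real (2 * \<alpha> * Re \<omega>) = of_real \<alpha> * (\<omega> + cnj \<omega>)"
    by (simp add: complex_add_cnj)
  have "A X - of_real (2 * \<alpha> * Re \<omega>) *\<^sub>C X =
      (\<Sum>k<N. \<omega> ^ k *\<^sub>C (A (G (s + k + 1)) - of_real (2 * \<alpha> * Re \<omega>) *\<^sub>C G (s + k + 1)))"
    unfolding X_def
    by (simp only: bounded_clinearD[OF A] complex_vector.scale_sum_right sum_subtractf[symmetric]
        complex_vector.scale_right_diff_distrib complex_vector.scale_left_commute)
  also have "\<dots> = of_real \<alpha> *\<^sub>C
      (\<Sum>k<N. \<omega> ^ k *\<^sub>C (G (s + k + 2) + G (s + k) - (\<omega> + cnj \<omega>) *\<^sub>C G (s + k + 1)))"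
    unfolding complex_vector.scale_sum_right two
    using AG[of "s + _"] by (intro sum.cong) (simp_all add: algebra_simps)
  also have "norm \<dots> \<le> \<alpha> * (M + M + M + M)"
    unfolding jacobi_wave_telescope[OF \<omega>]
    unfolding norm_scaleC norm_of_real abs_of_nonneg[OF \<alpha>]
    by (intro mult_left_mono[OF _ \<alpha>] norm_triangle_le norm_triangle_le_diff add_mono)
      (simp_all add: norm_scaleC norm_mult norm_power \<omega> G)
  finally show ?thesis by simp
qed

text \<open>A packet is a plane wave on a square of side \<open>n + 1\<close>. Before normalisation its norm is \<open>n + 1\<close>,
  while its defect as an eigenvector, living near the edges of the square, is of the order
  \<open>\<surd>(n + 1)\<close>. The horizontal offset \<open>(n + 1)\<^sup>2\<close> makes the squares of different packets disjoint. It also keeps the first index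
  positive, as the shift \<open>j + 1\<close> does for the second: the operators considered below act as discrete
  Laplacians only at positive indices.\<close>

definition wave_packet :: "(nat \<Rightarrow> nat \<Rightarrow> 'a::complex_inner) \<Rightarrow> complex \<Rightarrow> complex \<Rightarrow> nat \<Rightarrow> 'a" where
  "wave_packet g \<omega> \<psi> n = of_real (1 / Suc n) *\<^sub>C
    (\<Sum>k<Suc n. \<omega> ^ k *\<^sub>C (\<Sum>j<Suc n. \<psi> ^ j *\<^sub>C g ((Suc n)\<^sup>2 + k + 1) (j + 1)))"

lemma norm_wave_packet:
  assumes orth: "\<And>n m n' m'. cinner (g n m) (g n' m') = (if n = n' \<and> m = m' then 1 else 0)"
    and unimod: "cmod \<omega> = 1" "cmod \<psi> = 1"
  shows "norm (wave_packet g \<omega> \<psi> n) = 1"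
proof -
  let ?c = "\<lambda>(k, j). \<omega> ^ k * \<psi> ^ j" and ?g = "\<lambda>(k, j). g ((Suc n)\<^sup>2 + k + 1) (j + 1)"
  have "norm (\<Sum>i\<in>{..<Suc n} \<times> {..<Suc n}. ?c i *\<^sub>C ?g i) = sqrt (card ({..<Suc n} \<times> {..<Suc n}))"
    by (rule norm_sum_orthonormal) (auto simp: orth norm_mult norm_power unimod split: if_splits)
  moreover have "(\<Sum>i\<in>{..<Suc n} \<times> {..<Suc n}. ?c i *\<^sub>C ?g i) =
      (\<Sum>k<Suc n. \<omega> ^ k *\<^sub>C (\<Sum>j<Suc n. \<psi> ^ j *\<^sub>C g ((Suc n)\<^sup>2 + k + 1) (j + 1)))"
    by (simp add: sum.cartesian_product complex_vector.scale_sum_right case_prod_beta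
        del: sum.lessThan_Suc)
  moreover have "sqrt (card ({..<Suc n} \<times> {..<Suc n})) = Suc n"
    by (simp add: card_cartesian_product real_sqrt_mult del: of_nat_Suc mult_Suc mult_Suc_right)
  ultimately show ?thesis
    by (simp add: wave_packet_def norm_scaleC norm_divide del: sum.lessThan_Suc of_nat_Suc)
qed

lemma orthogonal_wave_packets:
  assumes orth: "\<And>n m n' m'. cinner (g n m) (g n' m') = (if n = n' \<and> m = m' then 1 else 0)"
    and "p \<noteq> q"
  shows "cinner (wave_packet g \<omega> \<psi> p) (wave_packet g \<omega> \<psi> q) = 0"
proof -
  have less: "(Suc a)\<^sup>2 + k < (Suc b)\<^sup>2 + l" if "a < b" "k < Suc a" for a b k l :: nat
  proof -
    have "(Suc a)\<^sup>2 + k < (Suc (Suc a))\<^sup>2"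
      using that by (simp add: power2_eq_square)
    also have "\<dots> \<le> (Suc b)\<^sup>2"
      using that by (intro power_mono) auto
    finally show ?thesis by simp
  qed
  have "(Suc p)\<^sup>2 + k + 1 \<noteq> (Suc q)\<^sup>2 + l + 1" if "k < Suc p" "l < Suc q" for k l
    using less[of p q k l] less[of q p l k] that \<open>p \<noteq> q\<close> by linarith
  then have "cinner (g ((Suc p)\<^sup>2 + k + 1) i) (g ((Suc q)\<^sup>2 + l + 1) j) = 0"
    if "k < Suc p" "l < Suc q" for k l i j
    using orth that by presburger
  then show ?thesis
    by (simp add: wave_packet_def cinner_sum_left cinner_sum_right cinner_scaleC_left
        cinner_scaleC_right del: sum.lessThan_Suc)
qed

lemma wave_packet_Weyl_sequence:
  fixes g :: "nat \<Rightarrow> nat \<Rightarrow> 'a::complex_inner"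
  assumes orth: "\<And>n m n' m'. cinner (g n m) (g n' m') = (if n = n' \<and> m = m' then 1 else 0)"
    and A: "bounded_clinear A" and B: "bounded_clinear B"
    and Ag: "\<And>n m. A (g (Suc n) m) = of_real \<alpha> *\<^sub>C (g (n + 2) m + g n m)"
    and Bg: "\<And>n m. B (g n (Suc m)) = of_real \<beta> *\<^sub>C (g n (m + 2) + g n m)"
    and unimod: "cmod \<omega> = 1" "cmod \<psi> = 1" and nonneg: "\<alpha> \<ge> 0" "\<beta> \<ge> 0"
  defines "z \<equiv> Complex (2 * \<alpha> * Re \<omega>) (2 * \<beta> * Re \<psi>)"
  shows "(\<lambda>n. (A (wave_packet g \<omega> \<psi> n) + \<i> *\<^sub>C B (wave_packet g \<omega> \<psi> n)) -
      z *\<^sub>C wave_packet g \<omega> \<psi> n) \<longlonglongrightarrow> 0"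
proof (rule Lim_null_comparison)
  let ?a = "complex_of_real (2 * \<alpha> * Re \<omega>)" and ?b = "complex_of_real (2 * \<beta> * Re \<psi>)"
  have bound: "norm (A X + \<i> *\<^sub>C B X - z *\<^sub>C X) \<le> (4 * \<alpha> + 4 * \<beta>) / sqrt (Suc n)"
    if X: "X = wave_packet g \<omega> \<psi> n" for X n
  proof -
    define N where "N = Suc n"
    have N: "real N > 0" by (simp add: N_def)
    define G where "G k = (\<Sum>j<N. \<psi> ^ j *\<^sub>C g k (j + 1))" for k
    define H where "H j = (\<Sum>k<N. \<omega> ^ k *\<^sub>C g (N\<^sup>2 + k + 1) j)" for j
    have "norm (G k) = sqrt (card {..<N})" "norm (H k) = sqrt (card {..<N})" for k
      unfolding G_def H_def
      by (rule norm_sum_orthonormal; simp add: orth norm_power unimod)+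
    then have norms: "norm (G k) \<le> sqrt N" "norm (H k) \<le> sqrt N" for k
      by simp_all
    have AG: "A (G (Suc k)) = of_real \<alpha> *\<^sub>C (G (k + 2) + G k)" for k
      by (simp add: G_def bounded_clinearD[OF A] Ag complex_vector.scale_sum_right
          complex_vector.scale_right_distrib sum.distrib mult.commute)
    have BH: "B (H (Suc k)) = of_real \<beta> *\<^sub>C (H (k + 2) + H k)" for k
      by (simp add: H_def bounded_clinearD[OF B] Bg complex_vector.scale_sum_right
          complex_vector.scale_right_distrib sum.distrib mult.commute)
    define Y where "Y = (\<Sum>k<N. \<omega> ^ k *\<^sub>C G (N\<^sup>2 + k + 1))"
    have Y': "Y = (\<Sum>j<N. \<psi> ^ j *\<^sub>C H (0 + j + 1))"
      unfolding Y_def G_def H_def complex_vector.scale_sum_right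
      by (subst sum.swap) (simp add: mult.commute)
    have XY: "X = of_real (1 / N) *\<^sub>C Y"
      by (simp add: X wave_packet_def Y_def G_def N_def del: sum.lessThan_Suc)
    have "norm (A Y - ?a *\<^sub>C Y) \<le> 4 * \<alpha> * sqrt N"
      by (rule jacobi_wave_defect[OF A AG unimod(1) nonneg(1) norms(1) Y_def])
    moreover have "norm (B Y - ?b *\<^sub>C Y) \<le> 4 * \<beta> * sqrt N"
      by (rule jacobi_wave_defect[OF B BH unimod(2) nonneg(2) norms(2) Y'])
    ultimately have "norm ((A Y - ?a *\<^sub>C Y) + \<i> *\<^sub>C (B Y - ?b *\<^sub>C Y)) \<le>
        4 * \<alpha> * sqrt N + 4 * \<beta> * sqrt N"
      by (intro norm_triangle_le add_mono) (simp_all add: norm_scaleC)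
    moreover have "A X + \<i> *\<^sub>C B X - z *\<^sub>C X =
        of_real (1 / N) *\<^sub>C ((A Y - ?a *\<^sub>C Y) + \<i> *\<^sub>C (B Y - ?b *\<^sub>C Y))"
    proof -
      have "z = ?a + \<i> * ?b" by (simp add: z_def complex_eq_iff)
      then show ?thesis
        by (simp add: XY bounded_clinearD[OF A] bounded_clinearD[OF B] algebra_simps)
    qed
    ultimately have "norm (A X + \<i> *\<^sub>C B X - z *\<^sub>C X) \<le>
        (1 / N) * (4 * \<alpha> * sqrt N + 4 * \<beta> * sqrt N)"
      using N by (simp add: norm_scaleC norm_divide divide_right_mono)
    also have "\<dots> = (4 * \<alpha> + 4 * \<beta>) * (sqrt N / N)"
      by (simp add: algebra_simps)
    also have "sqrt N / N = 1 / sqrt N"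
      using N by (simp add: field_simps)
    finally show ?thesis by (simp add: N_def)
  qed
  then show "\<forall>\<^sub>F n in sequentially. norm (A (wave_packet g \<omega> \<psi> n) + \<i> *\<^sub>C B (wave_packet g \<omega> \<psi> n) -
      z *\<^sub>C wave_packet g \<omega> \<psi> n) \<le> (4 * \<alpha> + 4 * \<beta>) / sqrt (Suc n)"
    by simp
  have "filterlim (\<lambda>n. sqrt (real (Suc n))) at_top sequentially"
    using filterlim_compose[OF sqrt_at_top filterlim_compose[OF filterlim_real_sequentially
      filterlim_Suc]] by (simp add: o_def)
  then show "(\<lambda>n. (4 * \<alpha> + 4 * \<beta>) / sqrt (Suc n)) \<longlonglongrightarrow> 0"
    by (rule real_tendsto_divide_at_top[OF tendsto_const])
qed


section \<open>An orthonormal system on which both field operators are shifts\<close>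

text \<open>The tensors \<open>u \<otimes> \<cdots> \<otimes> u \<otimes> v \<otimes> \<cdots> \<otimes> v\<close> of a given degree are not orthogonal to each other unless
  \<open>u\<close> and \<open>v\<close> are. A separating factor \<open>w\<close>, orthogonal to \<open>u\<close>, repairs this, and the field operators,
  acting at the two ends, do not reach it as long as the blocks on both sides are non-empty.\<close>

definition separated_tensor ::
    "('h::chilbert_space list \<Rightarrow> 'f::chilbert_space) \<Rightarrow> 'h \<Rightarrow> 'h \<Rightarrow> 'h \<Rightarrow> nat \<Rightarrow> nat \<Rightarrow> 'f" where
  "separated_tensor tens u w v n m =
    of_real (1 / (norm u ^ n * norm v ^ m * norm w)) *\<^sub>C
      tens (replicate n u @ w # replicate m v)"

lemma cinner_tens_replicate:
  assumes F: "full_fock_space tens"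
  shows "cinner (tens (replicate m v)) (tens (replicate m' v)) =
    (if m = m' then of_real (norm v ^ (2 * m)) else 0)"
proof (induction m arbitrary: m')
  case 0
  show ?case by (cases m') (simp_all add: cinner_tens[OF F])
next
  case (Suc m)
  then show ?case
    by (cases m') (simp_all add: cinner_tens[OF F] cinner_norm power2_eq_square)
qed

text \<open>If the separators stand at different positions, then the one further to the left is paired with
  a copy of \<open>u\<close> in the other tensor. If only the numbers of factors \<open>v\<close> differ, then so do the degrees.\<close>

lemma cinner_tens_separated:
  assumes F: "full_fock_space tens" and w: "cinner w u = 0"
  shows "cinner (tens (replicate n u @ w # replicate m v)) (tens (replicate n' u @ w # replicate m' v)) =
    (if n = n' \<and> m = m' then of_real ((norm u ^ n * norm v ^ m * norm w)\<^sup>2) else 0)"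
proof (induction n arbitrary: n')
  case 0
  show ?case
    using w
    by (cases n') (simp_all add: cinner_tens[OF F] cinner_tens_replicate[OF F] cinner_norm
        power_mult_distrib power_mult mult.commute power2_eq_square)
next
  case (Suc n)
  have "cinner u w = 0" using w cinner_commute[of u w] by simp
  then show ?case
    using Suc
    by (cases n') (simp_all add: cinner_tens[OF F] cinner_norm power_mult_distrib power2_eq_square)
qed

lemma orthonormal_separated_tensor:
  assumes F: "full_fock_space tens" and w: "cinner w u = 0"
    and nonzero: "u \<noteq> 0" "v \<noteq> 0" "w \<noteq> 0"
  shows "cinner (separated_tensor tens u w v n m) (separated_tensor tens u w v n' m') =
    (if n = n' \<and> m = m' then 1 else 0)"
proof -
  have "norm u ^ n * norm v ^ m * norm w \<noteq> 0" using nonzero by simp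
  then show ?thesis
    unfolding separated_tensor_def
    by (auto simp: cinner_scaleC_left cinner_scaleC_right cinner_tens_separated[OF F w]
        power2_eq_square simp flip: of_real_mult)
qed

text \<open>Left creation and annihilation only see the leftmost factor, and this is \<open>u\<close> as long as the first
  index is positive.\<close>

lemma left_field_operator_separated_tensor:
  assumes F: "full_fock_space tens" and u: "u \<noteq> 0"
  shows "field_operator tens u (separated_tensor tens u w v (Suc n) m) =
    of_real (norm u) *\<^sub>C (separated_tensor tens u w v (n + 2) m + separated_tensor tens u w v n m)"
proof -
  let ?t = "\<lambda>n. tens (replicate n u @ w # replicate m v)"
  have "field_operator tens u (?t (Suc n)) = ?t (n + 2) + of_real ((norm u)\<^sup>2) *\<^sub>C ?t n"
    by (simp add: field_operator(3)[OF F] cinner_norm)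
  then show ?thesis
    using u
    by (simp add: separated_tensor_def bounded_clinearD(3)[OF field_operator(1)[OF F]]
        complex_vector.scale_right_distrib field_simps power2_eq_square)
qed

lemma right_field_operator_separated_tensor:
  assumes F: "full_fock_space tens" and v: "v \<noteq> 0"
  shows "field_operator (tens \<circ> rev) v (separated_tensor tens u w v n (Suc m)) =
    of_real (norm v) *\<^sub>C (separated_tensor tens u w v n (m + 2) + separated_tensor tens u w v n m)"
proof -
  have "separated_tensor tens u w v n m = separated_tensor (tens \<circ> rev) v w u m n" for n m
    by (simp add: separated_tensor_def mult_ac)
  then show ?thesis
    using left_field_operator_separated_tensor[OF full_fock_space_rev[OF F] v] by simp
qed


section \<open>The cyclic subspace\<close>

lemma op_alg_orbit:
  fixes S :: "('a::complex_inner \<Rightarrow> 'a) set"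
  shows "csubspace ((\<lambda>A. A x) ` op_alg S)" and "x \<in> (\<lambda>A. A x) ` op_alg S"
    and "A \<in> S \<Longrightarrow> y \<in> (\<lambda>A. A x) ` op_alg S \<Longrightarrow> A y \<in> (\<lambda>A. A x) ` op_alg S"
proof -
  show "x \<in> (\<lambda>A. A x) ` op_alg S"
    by (rule image_eqI[where x = id]) (simp_all add: op_alg.one)
  have "0 \<in> (\<lambda>A. A x) ` op_alg S"
    by (rule image_eqI[where x = "\<lambda>x. 0 *\<^sub>C id x"])
      (use op_alg.scale[OF op_alg.one, of 0 S] in auto)
  then show "csubspace ((\<lambda>A. A x) ` op_alg S)"
    unfolding complex_vector.subspace_def
    using op_alg.add op_alg.scale by (fastforce simp: image_iff)
  show "A y \<in> (\<lambda>A. A x) ` op_alg S" if "A \<in> S" and y: "y \<in> (\<lambda>A. A x) ` op_alg S" for A y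
  proof -
    obtain C where "C \<in> op_alg S" "y = C x" using y by blast
    then show ?thesis
      using op_alg.mult[OF op_alg.gen[OF \<open>A \<in> S\<close>]] by (intro image_eqI[where x = "A \<circ> C"]) auto
  qed
qed

text \<open>As in the recursion of orthogonal polynomials, a field operator maps such a tensor to the next
  one plus a multiple of a shorter one. So all of them are obtained from the vacuum, growing first
  the block of factors \<open>v\<close> at its right end and then the block of factors \<open>u\<close> at its left end.\<close>

lemma tens_replicate_mem_invariant_subspace:
  assumes F: "full_fock_space tens" and D: "csubspace D" and vac: "tens [] \<in> D"
    and A: "\<And>x. x \<in> D \<Longrightarrow> field_operator tens u x \<in> D"
    and B: "\<And>x. x \<in> D \<Longrightarrow> field_operator (tens \<circ> rev) v x \<in> D"
  shows "tens (replicate n u @ replicate m v) \<in> D"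
proof -
  note diff = complex_vector.subspace_diff[OF D] and scale = complex_vector.subspace_scale[OF D]
  have right: "tens (replicate m v) \<in> D" for m
  proof (induction m rule: induct_nat_012)
    case 1
    show ?case
      using B[OF vac] field_operator(2)[OF full_fock_space_rev[OF F], of v] by simp
  next
    case (ge2 m)
    have "field_operator (tens \<circ> rev) v (tens (replicate (Suc m) v)) =
        tens (replicate (Suc (Suc m)) v) + cinner v v *\<^sub>C tens (replicate m v)"
      using field_operator(3)[OF full_fock_space_rev[OF F], of v v "replicate m v"]
      by (simp add: replicate_append_same)
    then show ?case
      using diff[OF B[OF ge2(2)] scale[OF ge2(1), of "cinner v v"]] by simp
  qed (use vac in simp)
  show ?thesis
  proof (induction n rule: induct_nat_012)
    case 0
    show ?case using right by simp
  next
    case 1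
    show ?case
    proof (cases m)
      case 0
      then show ?thesis
        using A[OF vac] field_operator(2)[OF F, of u] by simp
    next
      case (Suc k)
      then show ?thesis
        using diff[OF A[OF right[of m]] scale[OF right[of k], of "cinner v u"]]
          field_operator(3)[OF F, of u v "replicate k v"] by simp
    qed
  next
    case (ge2 n)
    then show ?case
      using diff[OF A[OF ge2(2)] scale[OF ge2(1), of "cinner u u"]]
        field_operator(3)[OF F, of u u "replicate n u @ replicate m v"] by simp
  qed
qed

lemma separated_tensor_mem_invariant_subspace:
  assumes F: "full_fock_space tens" and D: "csubspace D" and vac: "tens [] \<in> D"
    and A: "\<And>x. x \<in> D \<Longrightarrow> field_operator tens u x \<in> D"
    and B: "\<And>x. x \<in> D \<Longrightarrow> field_operator (tens \<circ> rev) v x \<in> D"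
  shows "separated_tensor tens u (v + c *\<^sub>C u) v n m \<in> D"
proof -
  note mem = tens_replicate_mem_invariant_subspace[OF F D vac A B]
  have "tens (replicate n u @ (v + c *\<^sub>C u) # replicate m v) =
      tens (replicate n u @ replicate (Suc m) v) + c *\<^sub>C tens (replicate (Suc n) u @ replicate m v)"
    using F by (simp add: full_fock_space_def replicate_app_Cons_same)
  then show ?thesis
    unfolding separated_tensor_def
    using mem complex_vector.subspace_add[OF D] complex_vector.subspace_scale[OF D] by metis
qed


section \<open>The spectra of the operator\<close>

theorem theorem3p3:
  fixes tens :: "'h::chilbert_space list \<Rightarrow> 'f::chilbert_space"
    and v1 v2 :: 'h and T :: "'f \<Rightarrow> 'f" and K :: "'f set"
  assumes "full_fock_space tens"
    and "v1 \<noteq> v2" and "cindependent {v1, v2}"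
    and "Im (cinner v1 v2) \<noteq> 0"
    and "T = (\<lambda>x. left_creation tens v1 x + cadjoint (left_creation tens v1) x
               + \<i> *\<^sub>C (right_creation tens v2 x + cadjoint (right_creation tens v2) x))"
    and "K = closure ((\<lambda>A. A (vacuum tens)) ` op_alg {T, cadjoint T})"
  shows "essential_spectrum K T =
           {z. \<bar>Re z\<bar> \<le> 2 * norm v1 \<and> \<bar>Im z\<bar> \<le> 2 * norm v2} \<and>
         op_spectrum K T =
           {z. \<bar>Re z\<bar> \<le> 2 * norm v1 \<and> \<bar>Im z\<bar> \<le> 2 * norm v2}"
proof -
  note F = assms(1)
  note F' = full_fock_space_rev[OF F]
  define A where "A = field_operator tens v1"
  define B where "B = field_operator (tens \<circ> rev) v2"
  note A = field_operator(1,5)[OF F, of v1, folded A_def]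
    and B = field_operator(1,5)[OF F', of v2, folded B_def]
  have T_eq: "T = (\<lambda>x. A x + \<i> *\<^sub>C B x)"
    by (simp add: assms(5) A_def B_def field_operator_def right_creation_eq_left_creation_rev)
  have T: "bounded_clinear T"
    unfolding T_eq by (intro bounded_clinear_add bounded_clinear_scale A B)
  have adj_T: "cadjoint T = (\<lambda>x. A x + (- \<i>) *\<^sub>C B x)"
    by (intro cadjoint_eqI bounded_clinear_add bounded_clinear_scale A B)
      (simp add: T_eq cinner_add_left cinner_add_right cinner_scaleC_left cinner_scaleC_right
        cinner_minus_left A B flip: complex_vector.scale_minus_left)
  define D where "D = (\<lambda>A. A (vacuum tens)) ` op_alg {T, cadjoint T}"
  have D: "csubspace D" and vac: "tens [] \<in> D"
    and TD: "\<And>x. x \<in> D \<Longrightarrow> T x \<in> D" and adj_TD: "\<And>x. x \<in> D \<Longrightarrow> cadjoint T x \<in> D"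
    unfolding D_def vacuum_def
    using op_alg_orbit[where S = "{T, cadjoint T}" and x = "tens []"] by simp_all
  have K_eq: "K = closure D" by (simp add: assms(6) D_def)
  have K: "csubspace K" "closed K"
    by (simp_all add: K_eq csubspace_closure D)
  have TK: "T x \<in> K" if "x \<in> K" for x
  proof -
    have "T x \<in> closure (T ` D)"
      using closure_bounded_linear_image_subset[OF bounded_clinearD(1)[OF T], of D] that
      by (auto simp: K_eq)
    also have "\<dots> \<subseteq> K" unfolding K_eq using TD by (intro closure_mono) auto
    finally show ?thesis .
  qed
  \<comment> \<open>The self-adjoint parts of \<open>T\<close> act on the cyclic subspace too.\<close>
  have AD: "A x \<in> D" if "x \<in> D" for x
  proof -
    have "(1 / 2) *\<^sub>C (T x + cadjoint T x) \<in> D"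
      using that TD adj_TD complex_vector.subspace_add[OF D] complex_vector.subspace_scale[OF D]
      by blast
    also have "(1 / 2) *\<^sub>C (T x + cadjoint T x) = A x"
    proof -
      have "T x + cadjoint T x = 2 *\<^sub>C A x"
        unfolding adj_T unfolding T_eq
        using complex_vector.scale_left_distrib[of 1 1 "A x"] by simp
      then show ?thesis by simp
    qed
    finally show ?thesis .
  qed
  have BD: "B x \<in> D" if "x \<in> D" for x
  proof -
    have "(- \<i>) *\<^sub>C (T x - A x) \<in> D"
      using that TD AD complex_vector.subspace_diff[OF D] complex_vector.subspace_scale[OF D]
      by blast
    also have "(- \<i>) *\<^sub>C (T x - A x) = B x"
      by (simp add: T_eq)
    finally show ?thesis .
  qed
  let ?rectangle = "{z. \<bar>Re z\<bar> \<le> 2 * norm v1 \<and> \<bar>Im z\<bar> \<le> 2 * norm v2}"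
  have "op_spectrum K T \<subseteq> ?rectangle"
  proof (rule op_spectrum_subset_numerical_rectangle[OF K T TK])
    fix x
    have "cinner (T x) x = cinner (A x) x + \<i> * cinner (B x) x"
      by (simp add: T_eq cinner_add_left cinner_scaleC_left)
    then show "\<bar>Re (cinner (T x) x)\<bar> \<le> 2 * norm v1 * (norm x)\<^sup>2"
      "\<bar>Im (cinner (T x) x)\<bar> \<le> 2 * norm v2 * (norm x)\<^sup>2"
      using cinner_field_operator_self[OF F, of v1 x] cinner_field_operator_self[OF F', of v2 x]
      by (simp_all add: A_def B_def)
  qed
  moreover have "?rectangle \<subseteq> essential_spectrum K T"
  proof
    fix z assume "z \<in> ?rectangle"
    then have z: "\<bar>Re z\<bar> \<le> 2 * norm v1" "\<bar>Im z\<bar> \<le> 2 * norm v2" by auto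
    have nonzero: "v1 \<noteq> 0" "v2 \<noteq> 0"
      using assms(3) complex_vector.dependent_zero[of "{v1, v2}"] unfolding cindependent_def by auto
    \<comment> \<open>The component of \<open>v2\<close> orthogonal to \<open>v1\<close>.\<close>
    define c where "c = - (cinner v2 v1 / cinner v1 v1)"
    define w where "w = v2 + c *\<^sub>C v1"
    have v1_sq: "cinner v1 v1 \<noteq> 0" using nonzero by (simp add: cinner_norm)
    then have orth: "cinner w v1 = 0"
      by (simp add: w_def c_def cinner_diff_left cinner_scaleC_left)
    have "w \<noteq> 0"
    proof
      assume "w = 0"
      then have "v2 = (- c) *\<^sub>C v1"
        by (simp add: w_def eq_neg_iff_add_eq_0)
      then have "v2 \<in> cspan {v1}"
        using complex_vector.span_scale[OF complex_vector.span_base[of v1 "{v1}"], of "- c"] by simp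
      then show False
        using assms(2,3) complex_vector.independent_insert[of v2 "{v1}"]
        by (simp add: cindependent_def insert_commute)
    qed
    define g where "g = separated_tensor tens v1 w v2"
    have orthonormal: "cinner (g n m) (g n' m') = (if n = n' \<and> m = m' then 1 else 0)" for n m n' m'
      unfolding g_def by (rule orthonormal_separated_tensor[OF F orth nonzero \<open>w \<noteq> 0\<close>])
    have gD: "g n m \<in> D" for n m
      unfolding g_def w_def
      using separated_tensor_mem_invariant_subspace[OF F D vac] AD BD by (simp add: A_def B_def)
    define \<omega> where "\<omega> = cis (arccos (Re z / (2 * norm v1)))"
    define \<psi> where "\<psi> = cis (arccos (Im z / (2 * norm v2)))"
    have unimod: "cmod \<omega> = 1" "cmod \<psi> = 1" by (simp_all add: \<omega>_def \<psi>_def)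
    have "Re \<omega> = Re z / (2 * norm v1)" "Re \<psi> = Im z / (2 * norm v2)"
      using z nonzero unfolding \<omega>_def \<psi>_def
      by (simp_all add: cos_arccos_abs abs_divide)
    then have z_eq: "Complex (2 * norm v1 * Re \<omega>) (2 * norm v2 * Re \<psi>) = z"
      using nonzero by (simp add: complex_eq_iff)
    have "(\<lambda>n. T (wave_packet g \<omega> \<psi> n) - z *\<^sub>C wave_packet g \<omega> \<psi> n) \<longlonglongrightarrow> 0"
      unfolding T_eq
      using wave_packet_Weyl_sequence[OF orthonormal A(1) B(1) _ _ unimod norm_ge_zero norm_ge_zero,
          of v1 v2]
        left_field_operator_separated_tensor[OF F nonzero(1)]
        right_field_operator_separated_tensor[OF F nonzero(2)]
      by (simp add: z_eq A_def B_def g_def)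
    moreover have "wave_packet g \<omega> \<psi> n \<in> K" for n
    proof -
      have "wave_packet g \<omega> \<psi> n \<in> D"
        unfolding wave_packet_def
        by (intro complex_vector.subspace_scale[OF D] complex_vector.subspace_sum[OF D] gD)
      then show ?thesis using closure_subset by (auto simp: K_eq)
    qed
    ultimately show "z \<in> essential_spectrum K T"
      by (intro orthonormal_Weyl_sequence_imp_essential_spectrum[OF K T TK, of "wave_packet g \<omega> \<psi>"]
          norm_wave_packet orthogonal_wave_packets orthonormal unimod)
  qed
  ultimately show ?thesis
    using essential_spectrum_subset_op_spectrum[OF K, of T] by blast
qed

end
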